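(* Let $G$ be a ($C_4$, prism)-free perfect graph and let $(H,v)$ be a twin wheel in $G$. Let $a,u,b$ be the neighbors of $v$ in $H$, appearing in this order when traversing $H$. Let $S_u=N[u]\setminus\{v\}$ and $S_v=N[v]\setminus\{u\}$. Then one of the following holds: (i) $S_u$ is a cutset of $G$ that separates $v$ from a vertex of $H\setminus\{a,u,b\}$ (i.e. some vertex of $V(H)\setminus\{a,u,b\}$ lies in a different connected component of $G\setminus S_u$ than $v$); (ii) $S_v$ is a cutset of $G$ that separates $u$ from a vertex of $H\setminus\{a,u,b\}$. In particular, either $v$ breaks $V(H)\setminus\{a,b\}$ or $u$ breaks $V(H)\setminus\{a,b\}$.
   Context: All graphs finite and simple. A hole is an induced cycle of length at least 4; $C_4$ is the hole of length 4. A prism is two vertex-disjoint triangles $\{a_1,a_2,a_3\}$, $\{b_1,b_2,b_3\}$ with three vertex-disjoint induced paths $P_i$ from $a_i$ to $b_i$ such that for $i<j$ the only edges between $V(P_i)$ and $V(P_j)$ are $a_ia_j,b_ib_j$. A wheel $(H,v)$ is a hole $H$ and a vertex $v$ with at least three neighbors in $H$; a sector is a subpath of $H$ of length $\ge1$ whose ends are adjacent to $v$ and whose interior is anticomplete to $v$; short if of length 1. A twin wheel is a wheel with exactly three sectors, exactly two of which are short. $N[x]$ is the closed neighborhood; for $X\subseteq V(G)$, $N[X]$ is $X$ together with all vertices having a neighbor in $X$. A cutset is a set $K$ with $G\setminus K$ disconnected. For $Y\subseteq V(G)$ and $x\notin Y$, $x$ breaks $Y$ if for every connected component $D$ of $G\setminus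 N[x]$, $Y\not\subseteq N[D]$.
   Formalization: In the last sentence, "breaks" is used without the condition x ∉ Y, since u lies in V(H)∖{a,b}; with that condition the sentence can fail, and without it "u breaks V(H)∖{a,b}" holds trivially. The dichotomy (i)/(ii) is stated in full. *)

theory Defs
  imports Main
begin

definition sgraph :: "'a set \<Rightarrow> ('a \<Rightarrow> 'a \<Rightarrow> bool) \<Rightarrow> bool" where
  "sgraph V E \<longleftrightarrow> finite V \<and> (\<forall>x y. E x y \<longrightarrow> x \<in> V \<and> y \<in> V)
     \<and> (\<forall>x y. E x y \<longrightarrow> E y x) \<and> (\<forall>x. \<not> E x x)"

definition clique :: "('a \<Rightarrow> 'a \<Rightarrow> bool) \<Rightarrow> 'a set \<Rightarrow> bool" where
  "clique E K \<longleftrightarrow> (\<forall>x\<in>K. \<forall>y\<in>K. x \<noteq> y \<longrightarrow> E x y)"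

definition clique_number :: "('a \<Rightarrow> 'a \<Rightarrow> bool) \<Rightarrow> 'a set \<Rightarrow> nat" where
  "clique_number E X = Max {card K | K. K \<subseteq> X \<and> clique E K}"

definition colorable :: "('a \<Rightarrow> 'a \<Rightarrow> bool) \<Rightarrow> 'a set \<Rightarrow> nat \<Rightarrow> bool" where
  "colorable E X k \<longleftrightarrow> (\<exists>f::'a \<Rightarrow> nat. (\<forall>x\<in>X. f x < k)
      \<and> (\<forall>x\<in>X. \<forall>y\<in>X. E x y \<longrightarrow> f x \<noteq> f y))"

definition chromatic_number :: "('a \<Rightarrow> 'a \<Rightarrow> bool) \<Rightarrow> 'a set \<Rightarrow> nat" where
  "chromatic_number E X = (LEAST k. colorable E X k)"

definition perfect :: "'a set \<Rightarrow> ('a \<Rightarrow> 'a \<Rightarrow> bool) \<Rightarrow> bool" where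
  "perfect V E \<longleftrightarrow> (\<forall>X\<subseteq>V. chromatic_number E X = clique_number E X)"

definition is_hole :: "'a set \<Rightarrow> ('a \<Rightarrow> 'a \<Rightarrow> bool) \<Rightarrow> 'a list \<Rightarrow> bool" where
  "is_hole V E xs \<longleftrightarrow> length xs \<ge> 4 \<and> distinct xs \<and> set xs \<subseteq> V \<and>
     (\<forall>i<length xs. \<forall>j<length xs.
        E (xs!i) (xs!j) \<longleftrightarrow> (j = Suc i mod length xs \<or> i = Suc j mod length xs))"

definition C4_free :: "'a set \<Rightarrow> ('a \<Rightarrow> 'a \<Rightarrow> bool) \<Rightarrow> bool" where
  "C4_free V E \<longleftrightarrow> \<not> (\<exists>xs. is_hole V E xs \<and> length xs = 4)"

definition induced_path :: "'a set \<Rightarrow> ('a \<Rightarrow> 'a \<Rightarrow> bool) \<Rightarrow> 'a list \<Rightarrow> bool" where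
  "induced_path V E p \<longleftrightarrow> p \<noteq> [] \<and> distinct p \<and> set p \<subseteq> V \<and>
     (\<forall>i<length p. \<forall>j<length p. E (p!i) (p!j) \<longleftrightarrow> (j = Suc i \<or> i = Suc j))"

definition is_prism :: "'a set \<Rightarrow> ('a \<Rightarrow> 'a \<Rightarrow> bool) \<Rightarrow> 'a list \<Rightarrow> 'a list \<Rightarrow> 'a list \<Rightarrow> bool" where
  "is_prism V E P1 P2 P3 \<longleftrightarrow>
     (let P = (\<lambda>i::nat. if i = 1 then P1 else if i = 2 then P2 else P3) in
      (\<forall>i\<in>{1,2,3}. induced_path V E (P i)) \<and>
      distinct [hd P1, hd P2, hd P3, last P1, last P2, last P3] \<and>
      (\<forall>i\<in>{1,2,3}. \<forall>j\<in>{1,2,3}. i \<noteq> j \<longrightarrow>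
         set (P i) \<inter> set (P j) = {} \<and>
         E (hd (P i)) (hd (P j)) \<and> E (last (P i)) (last (P j)) \<and>
         (\<forall>x\<in>set (P i). \<forall>y\<in>set (P j). E x y \<longrightarrow>
            (x = hd (P i) \<and> y = hd (P j)) \<or> (x = last (P i) \<and> y = last (P j)))))"

definition prism_free :: "'a set \<Rightarrow> ('a \<Rightarrow> 'a \<Rightarrow> bool) \<Rightarrow> bool" where
  "prism_free V E \<longleftrightarrow> \<not> (\<exists>P1 P2 P3. is_prism V E P1 P2 P3)"

definition is_wheel :: "'a set \<Rightarrow> ('a \<Rightarrow> 'a \<Rightarrow> bool) \<Rightarrow> 'a list \<Rightarrow> 'a \<Rightarrow> bool" where
  "is_wheel V E H v \<longleftrightarrow> is_hole V E H \<and> v \<in> V \<and> v \<notin> set H \<and>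
     card {x\<in>set H. E v x} \<ge> 3"

definition hsubpath :: "'a list \<Rightarrow> nat \<Rightarrow> nat \<Rightarrow> 'a set" where
  "hsubpath H i l = {H ! ((i + j) mod length H) | j. j \<le> l}"

definition is_sector :: "('a \<Rightarrow> 'a \<Rightarrow> bool) \<Rightarrow> 'a list \<Rightarrow> 'a \<Rightarrow> nat \<Rightarrow> nat \<Rightarrow> bool" where
  "is_sector E H v i l \<longleftrightarrow> i < length H \<and> 1 \<le> l \<and> l < length H \<and>
     E v (H ! i) \<and> E v (H ! ((i + l) mod length H)) \<and>
     (\<forall>j. 0 < j \<and> j < l \<longrightarrow> \<not> E v (H ! ((i + j) mod length H)))"

definition sectors :: "('a \<Rightarrow> 'a \<Rightarrow> bool) \<Rightarrow> 'a list \<Rightarrow> 'a \<Rightarrow> 'a set set" where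
  "sectors E H v = {hsubpath H i l | i l. is_sector E H v i l}"

definition short_sectors :: "('a \<Rightarrow> 'a \<Rightarrow> bool) \<Rightarrow> 'a list \<Rightarrow> 'a \<Rightarrow> 'a set set" where
  "short_sectors E H v = {hsubpath H i 1 | i. is_sector E H v i 1}"

definition twin_wheel :: "'a set \<Rightarrow> ('a \<Rightarrow> 'a \<Rightarrow> bool) \<Rightarrow> 'a list \<Rightarrow> 'a \<Rightarrow> bool" where
  "twin_wheel V E H v \<longleftrightarrow> is_wheel V E H v \<and> card (sectors E H v) = 3
     \<and> card (short_sectors E H v) = 2"

definition cnbhd :: "'a set \<Rightarrow> ('a \<Rightarrow> 'a \<Rightarrow> bool) \<Rightarrow> 'a \<Rightarrow> 'a set" where
  "cnbhd V E x = {x} \<union> {y\<in>V. E x y}"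

definition cnbhd_set :: "'a set \<Rightarrow> ('a \<Rightarrow> 'a \<Rightarrow> bool) \<Rightarrow> 'a set \<Rightarrow> 'a set" where
  "cnbhd_set V E X = X \<union> {y\<in>V. \<exists>x\<in>X. E x y}"

definition connected_in :: "('a \<Rightarrow> 'a \<Rightarrow> bool) \<Rightarrow> 'a set \<Rightarrow> 'a \<Rightarrow> 'a \<Rightarrow> bool" where
  "connected_in E X x y \<longleftrightarrow> x \<in> X \<and> y \<in> X \<and>
     (\<lambda>a b. a \<in> X \<and> b \<in> X \<and> E a b)\<^sup>*\<^sup>* x y"

definition components :: "('a \<Rightarrow> 'a \<Rightarrow> bool) \<Rightarrow> 'a set \<Rightarrow> 'a set set" where
  "components E X = {{y. connected_in E X x y} | x. x \<in> X}"

definition is_cutset :: "'a set \<Rightarrow> ('a \<Rightarrow> 'a \<Rightarrow> bool) \<Rightarrow> 'a set \<Rightarrow> bool" where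
  "is_cutset V E K \<longleftrightarrow> K \<subseteq> V \<and>
     (\<exists>x\<in>V - K. \<exists>y\<in>V - K. \<not> connected_in E (V - K) x y)"

definition breaks :: "'a set \<Rightarrow> ('a \<Rightarrow> 'a \<Rightarrow> bool) \<Rightarrow> 'a \<Rightarrow> 'a set \<Rightarrow> bool" where
  "breaks V E x Y \<longleftrightarrow>
     (\<forall>D\<in>components E (V - cnbhd V E x). \<not> Y \<subseteq> cnbhd_set V E D)"

end

theory Submission
  imports Defs
begin

text \<open>Suppose that \<open>S\<^sub>u\<close> and \<open>S\<^sub>v\<close> both fail to separate, and let \<open>K\<close> be the component of
  \<open>G - N[u] - N[v]\<close> containing \<open>H - {a, u, b}\<close>. Then \<open>v\<close> has a neighbor \<open>p\<close> outside \<open>N[u]\<close> and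
  \<open>u\<close> has a neighbor \<open>q\<close> outside \<open>N[v]\<close>, both attached to \<open>K\<close>. A path from \<open>p\<close> to \<open>q\<close> through
  \<open>K\<close> closes to a hole \<open>C\<close> containing the edge \<open>uv\<close>, whose ends are both adjacent to \<open>a\<close> and \<open>b\<close>.
  A parity count on the two wheels with rim \<open>C\<close> shows that either one of \<open>a\<close>, \<open>b\<close> has no further
  neighbor on \<open>C\<close>, or each has exactly one, \<open>p\<close> for one of them and \<open>q\<close> for the other. In the
  first case a shortest path through \<open>K\<close> from that hub to \<open>C\<close> yields a prism or an odd hole; in
  the second case a shortest path from \<open>{a, b}\<close> to \<open>C - {u, v, p, q}\<close> closes to two holes of
  different parity.\<close>

subsection \<open>Holes and induced paths\<close>

lemma sgraph_sym: "sgraph V E \<Longrightarrow> E x y \<longleftrightarrow> E y x"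
  unfolding sgraph_def by blast

lemma sgraph_irrefl: "sgraph V E \<Longrightarrow> \<not> E x x"
  unfolding sgraph_def by blast

lemma sgraph_in: "sgraph V E \<Longrightarrow> E x y \<Longrightarrow> x \<in> V \<and> y \<in> V"
  unfolding sgraph_def by blast

section \<open>Parity of holes in a perfect graph\<close>

lemma is_hole_nth_edge:
  assumes "is_hole V E xs" and "i < length xs" and "j < length xs"
  shows "E (xs ! i) (xs ! j) \<longleftrightarrow> j = Suc i \<or> i = Suc j
    \<or> i = 0 \<and> j = length xs - 1 \<or> j = 0 \<and> i = length xs - 1"
proof -
  have m: "Suc k mod length xs = (if k = length xs - 1 then 0 else Suc k)" if "k < length xs" for k
    using that by (cases "Suc k = length xs") auto
  show ?thesis
    using assms m[of i] m[of j] unfolding is_hole_def by (auto split: if_splits)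
qed

lemma hole_triangle_free:
  assumes h: "is_hole V E xs" and "x \<in> set xs" "y \<in> set xs" "z \<in> set xs"
    and "E x y" "E y z" "E x z"
  shows False
proof -
  have n: "4 \<le> length xs" using h unfolding is_hole_def by blast
  obtain i j k where "i < length xs" "j < length xs" "k < length xs"
    "x = xs ! i" "y = xs ! j" "z = xs ! k"
    using assms(2-4) by (metis in_set_conv_nth)
  then have "j = Suc i \<or> i = Suc j \<or> i = 0 \<and> j = length xs - 1 \<or> j = 0 \<and> i = length xs - 1"
    "k = Suc j \<or> j = Suc k \<or> j = 0 \<and> k = length xs - 1 \<or> k = 0 \<and> j = length xs - 1"
    "k = Suc i \<or> i = Suc k \<or> i = 0 \<and> k = length xs - 1 \<or> k = 0 \<and> i = length xs - 1"
    using assms(5-7) is_hole_nth_edge[OF h] by simp_all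
  then show False
    using n by linarith
qed

text \<open>Two colors must alternate along the hole, so the color is decided by the parity of the
  index. With odd length the closing edge joins two even indices.\<close>

lemma odd_hole_not_2_colorable:
  assumes h: "is_hole V E xs" and o: "odd (length xs)"
  shows "\<not> colorable E (set xs) 2"
proof
  assume "colorable E (set xs) 2"
  then obtain f :: "'a \<Rightarrow> nat" where f: "\<forall>x\<in>set xs. f x < 2"
    "\<forall>x\<in>set xs. \<forall>y\<in>set xs. E x y \<longrightarrow> f x \<noteq> f y"
    unfolding colorable_def by blast
  have n: "4 \<le> length xs" using h unfolding is_hole_def by blast
  have alt: "i < length xs \<Longrightarrow> f (xs ! i) = f (xs ! 0) \<longleftrightarrow> even i" for i
  proof (induction i)
    case (Suc i)
    have "f (xs ! i) \<noteq> f (xs ! Suc i)"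
      using f(2) Suc.prems is_hole_nth_edge[OF h, of i "Suc i"] by auto
    moreover have "f (xs ! i) < 2" "f (xs ! Suc i) < 2" "f (xs ! 0) < 2"
      by (use f(1) Suc.prems in \<open>force intro: bspec[OF f(1)] nth_mem\<close>)+
    ultimately show ?case using Suc by auto
  qed simp
  have "E (xs ! 0) (xs ! (length xs - 1))"
    using is_hole_nth_edge[OF h, of 0 "length xs - 1"] n by force
  then have "f (xs ! 0) \<noteq> f (xs ! (length xs - 1))"
    using f(2) n by (metis Suc_pred' diff_less less_eq_Suc_le lessI nth_mem o odd_pos zero_less_one)
  moreover have "length xs - 1 < length xs" using n by linarith
  ultimately show False using alt[of "length xs - 1"] o by simp
qed

text \<open>A hole has no triangle, so its clique number, and by perfection its chromatic number, is
  at most 2, which an odd cycle does not allow.\<close>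

lemma perfect_hole_even:
  assumes g: "sgraph V E" and pf: "perfect V E" and h: "is_hole V E xs"
  shows "even (length xs)"
proof (rule ccontr)
  assume o: "odd (length xs)"
  let ?X = "set xs"
  have sub: "?X \<subseteq> V" using h unfolding is_hole_def by blast
  have card_le: "card K \<le> 2" if K: "K \<subseteq> ?X" "clique E K" for K
  proof (rule ccontr)
    assume "\<not> card K \<le> 2"
    then have "Suc (Suc (Suc 0)) \<le> card K" by simp
    then obtain x y z where "x \<in> K" "y \<in> K" "z \<in> K" "x \<noteq> y" "y \<noteq> z" "x \<noteq> z"
      unfolding card_le_Suc_iff by auto
    then show False
      using hole_triangle_free[OF h, of x y z] K unfolding clique_def by blast
  qed
  have fin: "finite {card K | K. K \<subseteq> ?X \<and> clique E K}"
    by (rule finite_subset[of _ "{..2}"]) (use card_le in auto)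
  have "card {} \<in> {card K | K. K \<subseteq> ?X \<and> clique E K}"
    by (intro CollectI exI[of _ "{}"]) (auto simp: clique_def)
  then have "clique_number E ?X \<le> 2"
    unfolding clique_number_def using fin card_le by (subst Max_le_iff) auto
  then have le: "chromatic_number E ?X \<le> 2"
    using pf sub unfolding perfect_def by simp
  \<comment> \<open>An injective numbering is a proper coloring. Some coloring has to be exhibited
    for the \<open>LEAST\<close> in \<open>chromatic_number\<close> to be attained.\<close>
  obtain f :: "'a \<Rightarrow> nat" where f: "inj_on f ?X" "f ` ?X = {0..<card ?X}"
    using ex_bij_betw_finite_nat[of ?X] unfolding bij_betw_def by auto
  have "colorable E ?X (card ?X)"
    unfolding colorable_def
    by (rule exI[of _ f]) (use f sgraph_irrefl[OF g] in \<open>auto dest: inj_onD\<close>)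
  then have "colorable E ?X (chromatic_number E ?X)"
    unfolding chromatic_number_def by (rule LeastI)
  then have "colorable E ?X 2"
    using le unfolding colorable_def by (meson order_less_le_trans)
  then show False using odd_hole_not_2_colorable[OF h o] by simp
qed

section \<open>Gluing induced paths, closing them to holes, and shortest paths\<close>

lemma induced_path_single: "sgraph V E \<Longrightarrow> x \<in> V \<Longrightarrow> induced_path V E [x]"
  unfolding induced_path_def sgraph_def by auto

lemma induced_path_append:
  assumes g: "sgraph V E" and p: "induced_path V E p" and q: "induced_path V E q"
    and dis: "set p \<inter> set q = {}"
    and E: "\<And>x y. x \<in> set p \<Longrightarrow> y \<in> set q \<Longrightarrow> E x y \<longleftrightarrow> x = last p \<and> y = hd q"
  shows "induced_path V E (p @ q)"
proof -
  have ne: "p \<noteq> []" "q \<noteq> []" and d: "distinct p" "distinct q"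
    using p q unfolding induced_path_def by auto
  have cross: "E (p ! i) (q ! j) \<longleftrightarrow> Suc i = length p \<and> j = 0"
    if "i < length p" "j < length q" for i j
  proof -
    have "p ! i = last p \<longleftrightarrow> Suc i = length p"
      using that d ne by (auto simp: last_conv_nth nth_eq_iff_index_eq)
    moreover have "q ! j = hd q \<longleftrightarrow> j = 0"
      using that d ne by (auto simp: hd_conv_nth nth_eq_iff_index_eq)
    ultimately show ?thesis using E that by simp
  qed
  have "E ((p @ q) ! i) ((p @ q) ! j) \<longleftrightarrow> j = Suc i \<or> i = Suc j"
    if i: "i < length (p @ q)" and j: "j < length (p @ q)" for i j
  proof (cases "i < length p"; cases "j < length p")
    assume "i < length p" "j < length p"
    then show ?thesis using p unfolding induced_path_def by (simp add: nth_append)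
  next
    assume a: "i < length p" "\<not> j < length p"
    then have "E ((p @ q) ! i) ((p @ q) ! j) \<longleftrightarrow> Suc i = length p \<and> j - length p = 0"
      using j cross[of i "j - length p"] by (simp add: nth_append)
    then show ?thesis using a by linarith
  next
    assume a: "\<not> i < length p" "j < length p"
    then have "E ((p @ q) ! i) ((p @ q) ! j) \<longleftrightarrow> Suc j = length p \<and> i - length p = 0"
      using i cross[of j "i - length p"] sgraph_sym[OF g, of "q ! (i - length p)" "p ! j"]
      by (simp add: nth_append)
    then show ?thesis using a by linarith
  next
    assume a: "\<not> i < length p" "\<not> j < length p"
    then have "E ((p @ q) ! i) ((p @ q) ! j) \<longleftrightarrow>
        j - length p = Suc (i - length p) \<or> i - length p = Suc (j - length p)"
      using q i j unfolding induced_path_def by (simp add: nth_append)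
    then show ?thesis using a by linarith
  qed
  then show ?thesis
    using p q dis unfolding induced_path_def by auto
qed

lemma induced_path_Cons:
  assumes g: "sgraph V E" and "x \<in> V" and "induced_path V E p" and "x \<notin> set p"
    and "\<And>y. y \<in> set p \<Longrightarrow> E x y \<longleftrightarrow> y = hd p"
  shows "induced_path V E (x # p)"
  using induced_path_append[OF g induced_path_single[OF g], of x p] assms by simp

lemma induced_path_snoc:
  assumes g: "sgraph V E" and "x \<in> V" and "induced_path V E p" and "x \<notin> set p"
    and "\<And>y. y \<in> set p \<Longrightarrow> E y x \<longleftrightarrow> y = last p"
  shows "induced_path V E (p @ [x])"
  using induced_path_append[OF g _ induced_path_single[OF g], of p x] assms by simp

lemma induced_path_rev:
  assumes "induced_path V E p"
  shows "induced_path V E (rev p)"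
proof -
  have "E (rev p ! i) (rev p ! j) \<longleftrightarrow> j = Suc i \<or> i = Suc j"
    if "i < length p" "j < length p" for i j
  proof -
    have "E (rev p ! i) (rev p ! j) \<longleftrightarrow>
        length p - Suc j = Suc (length p - Suc i) \<or> length p - Suc i = Suc (length p - Suc j)"
      using assms that unfolding induced_path_def by (simp add: rev_nth)
    then show ?thesis using that by linarith
  qed
  then show ?thesis using assms unfolding induced_path_def by simp
qed

text \<open>With three or more vertices on \<open>p\<close> its ends are nonadjacent, so the two
  edges at \<open>x\<close> close it to an induced cycle of length at least 4.\<close>

lemma is_hole_Cons:
  assumes g: "sgraph V E" and p: "induced_path V E p" and l: "3 \<le> length p"
    and x: "x \<in> V" "x \<notin> set p"
    and E: "\<And>y. y \<in> set p \<Longrightarrow> E x y \<longleftrightarrow> y = hd p \<or> y = last p"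
  shows "is_hole V E (x # p)"
proof -
  have ne: "p \<noteq> []" and d: "distinct p" and sub: "set p \<subseteq> V"
    and pE: "\<And>i j. i < length p \<Longrightarrow> j < length p \<Longrightarrow> E (p ! i) (p ! j) \<longleftrightarrow> j = Suc i \<or> i = Suc j"
    using p unfolding induced_path_def by auto
  have xE: "E x (p ! j) \<longleftrightarrow> j = 0 \<or> Suc j = length p" if "j < length p" for j
  proof -
    have "p ! j = last p \<longleftrightarrow> Suc j = length p"
      using that d ne by (auto simp: last_conv_nth nth_eq_iff_index_eq)
    moreover have "p ! j = hd p \<longleftrightarrow> j = 0"
      using that d ne by (auto simp: hd_conv_nth nth_eq_iff_index_eq)
    ultimately show ?thesis using E that by simp
  qed
  have m: "Suc k mod Suc (length p) = (if k = length p then 0 else Suc k)" if "k \<le> length p" for k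
    using that by auto
  have "E ((x # p) ! i) ((x # p) ! j) \<longleftrightarrow>
      (j = Suc i mod length (x # p) \<or> i = Suc j mod length (x # p))"
    if "i < length (x # p)" "j < length (x # p)" for i j
  proof (cases i; cases j)
    fix i' j' assume ij: "i = Suc i'" "j = Suc j'"
    have "Suc i mod Suc (length p) = (if i = length p then 0 else Suc i)"
      "Suc j mod Suc (length p) = (if j = length p then 0 else Suc j)"
      using that m by auto
    then show ?thesis using that pE[of i' j'] ij by (auto split: if_splits)
  next
    fix j' assume "i = 0" "j = Suc j'"
    then show ?thesis using that xE[of j'] m[of j] l by (auto split: if_splits)
  next
    fix i' assume "i = Suc i'" "j = 0"
    then show ?thesis using that xE[of i'] sgraph_sym[OF g, of x] m[of i] l by (auto split: if_splits)
  next
    assume "i = 0" "j = 0"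
    then show ?thesis using sgraph_irrefl[OF g] l by auto
  qed
  then show ?thesis using l d sub x unfolding is_hole_def by auto
qed

text \<open>A walk of minimum length from \<open>S\<close> to \<open>T\<close> inside
  \<open>K\<close> works: a later \<open>S\<close>-vertex, an earlier \<open>T\<close>-vertex, a
  repetition or a chord would each give a shorter one.\<close>

lemma shortest_path:
  assumes g: "sgraph V E" and KV: "K \<subseteq> V"
    and p: "p \<noteq> []" "successively E p" "set p \<subseteq> K" "S (hd p)" "T (last p)"
  obtains f where "induced_path V E f" "set f \<subseteq> K" "S (hd f)" "T (last f)"
    "\<And>z. z \<in> set f \<Longrightarrow> S z \<Longrightarrow> z = hd f" "\<And>z. z \<in> set f \<Longrightarrow> T z \<Longrightarrow> z = last f"
proof -
  let ?Q = "\<lambda>p. p \<noteq> [] \<and> successively E p \<and> set p \<subseteq> K \<and> S (hd p) \<and> T (last p)"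
  have "?Q p" using p by blast
  then obtain f where f: "?Q f" and minf: "\<And>f'. ?Q f' \<Longrightarrow> length f \<le> length f'"
    using ex_has_least_nat[of ?Q p length] by blast
  have S0: "i = 0" if "i < length f" "S (f ! i)" for i
  proof -
    have "?Q (drop i f)"
      using f that by (auto simp: hd_drop_conv_nth successively_append_iff dest: in_set_dropD)
        (metis append_take_drop_id successively_append_iff)
    from minf[OF this] show ?thesis using that by simp
  qed
  have T0: "Suc i = length f" if "i < length f" "T (f ! i)" for i
  proof -
    have "successively E (take (Suc i) f)"
      using f by (metis append_take_drop_id successively_append_iff)
    then have "?Q (take (Suc i) f)"
      using f that by (auto simp: take_Suc_conv_app_nth hd_append hd_conv_nth dest: in_set_takeD)
    from minf[OF this] show ?thesis using that by simp
  qed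
  have sh: False if ij: "i < j" "j < length f" and c: "f ! i = f ! j \<or> E (f ! i) (f ! j) \<and> Suc i < j" for i j
  proof -
    \<comment> \<open>The shortcut keeps the first \<open>k\<close> entries and resumes at
      \<open>j\<close>. For a repetition the copy at \<open>i\<close> is dropped; for a chord the
      vertex at \<open>i\<close> is kept.\<close>
    define k where "k = (if f ! i = f ! j then i else Suc i)"
    have k: "k < j" "k > 0 \<Longrightarrow> E (f ! (k - 1)) (f ! j)"
      using ij c f successively_nth[of E f "i - 1"] unfolding k_def by (auto split: if_splits)
    have s: "successively E (take k f)" "successively E (drop j f)"
      using f by (metis append_take_drop_id successively_append_iff)+
    have lastk: "last (take k f) = f ! (k - 1)" if "k > 0"
      using that ij k f by (auto simp: last_conv_nth min_def)
    have h: "hd (take k f @ drop j f) = f ! 0"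
    proof (cases "k = 0")
      case True
      then have "f ! j = f ! 0" using ij unfolding k_def by (auto split: if_splits)
      then show ?thesis using True ij by (simp add: hd_drop_conv_nth)
    next
      case False
      then show ?thesis using ij f by (auto simp: hd_append hd_conv_nth)
    qed
    have "successively E (take k f @ drop j f)"
      unfolding successively_append_iff
      using s k lastk ij by (cases "k = 0") (auto simp: hd_drop_conv_nth)
    moreover have "last (take k f @ drop j f) = last f" using ij by simp
    moreover have "S (hd (take k f @ drop j f))"
      unfolding h using f by (auto simp: hd_conv_nth)
    moreover have "set (take k f @ drop j f) \<subseteq> K"
      using f by (auto dest: in_set_takeD in_set_dropD)
    ultimately have "?Q (take k f @ drop j f)" using f ij by simp
    from minf[OF this] show False using ij k by simp
  qed
  have dis: "distinct f"
    unfolding distinct_conv_nth by (metis linorder_neqE_nat sh)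
  have E1: "E (f ! i) (f ! Suc i)" if "Suc i < length f" for i
    using f that by (simp add: successively_conv_nth)
  have "E (f ! i) (f ! j) \<longleftrightarrow> j = Suc i \<or> i = Suc j" if "i < length f" "j < length f" for i j
  proof (cases i j rule: linorder_cases)
    case less
    then show ?thesis using that E1 sh[of i j] by (cases "Suc i = j") auto
  next
    case equal
    then show ?thesis using sgraph_irrefl[OF g] by simp
  next
    case greater
    then show ?thesis
      using that E1[of j] sh[of j i] sgraph_sym[OF g, of "f ! i" "f ! j"]
      by (cases "Suc j = i") auto
  qed
  then have "induced_path V E f"
    using f dis KV unfolding induced_path_def by auto
  then show thesis
  proof (rule that)
    show "set f \<subseteq> K" "S (hd f)" "T (last f)" using f by auto
    show "z = hd f" if "z \<in> set f" "S z" for z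
      using that S0 f by (metis hd_conv_nth in_set_conv_nth)
    show "z = last f" if "z \<in> set f" "T z" for z
      using that T0 f by (metis diff_Suc_1 in_set_conv_nth last_conv_nth)
  qed
qed

lemma connected_in_walk:
  assumes "connected_in E K x y"
  obtains p where "p \<noteq> []" "successively E p" "set p \<subseteq> K" "hd p = x" "last p = y"
proof -
  have "(\<lambda>a b. a \<in> K \<and> b \<in> K \<and> E a b)\<^sup>*\<^sup>* x y" "x \<in> K"
    using assms unfolding connected_in_def by auto
  then have "\<exists>p. p \<noteq> [] \<and> successively E p \<and> set p \<subseteq> K \<and> hd p = x \<and> last p = y"
  proof (induction rule: rtranclp_induct)
    case base
    then show ?case by (intro exI[of _ "[x]"]) auto
  next
    case (step y z)
    then obtain p where "p \<noteq> []" "successively E p" "set p \<subseteq> K" "hd p = x" "last p = y" by blast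
    with step show ?case
      by (intro exI[of _ "p @ [z]"]) (auto simp: successively_append_iff)
  qed
  then show thesis using that by blast
qed

text \<open>A shortest path from \<open>S\<close> to the vertices that lie in \<open>Z\<close> or see \<open>Z\<close> stops before entering \<open>Z\<close>.\<close>
lemma attaching_path:
  assumes g: "sgraph V E" and KV: "K \<subseteq> V" and con: "connected_in E K x y"
    and "S x" and "y \<in> Z" and SZ: "\<And>z. z \<in> Z \<Longrightarrow> \<not> S z"
  obtains f where "induced_path V E f" "set f \<subseteq> K" "set f \<inter> Z = {}" "S (hd f)"
    "\<And>z. z \<in> set f \<Longrightarrow> S z \<Longrightarrow> z = hd f"
    "\<exists>y\<in>Z. E (last f) y" "\<And>z y. z \<in> set f \<Longrightarrow> y \<in> Z \<Longrightarrow> E z y \<Longrightarrow> z = last f"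
proof -
  let ?T = "\<lambda>z. z \<in> Z \<or> (\<exists>y\<in>Z. E z y)"
  obtain p where p: "p \<noteq> []" "successively E p" "set p \<subseteq> K" "hd p = x" "last p = y"
    using connected_in_walk[OF con] .
  obtain f where f: "induced_path V E f" "set f \<subseteq> K" "S (hd f)" "?T (last f)"
    "\<And>z. z \<in> set f \<Longrightarrow> S z \<Longrightarrow> z = hd f" "\<And>z. z \<in> set f \<Longrightarrow> ?T z \<Longrightarrow> z = last f"
    using shortest_path[OF g KV p(1-3), of S ?T] p assms by auto
  have ne: "f \<noteq> []" and d: "distinct f" using f(1) unfolding induced_path_def by auto
  have "last f \<notin> Z"
  proof
    assume l: "last f \<in> Z"
    then have "last f \<noteq> hd f" using SZ f(3) by metis
    then have len: "2 \<le> length f"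
      using ne by (cases f rule: list.exhaust) (auto simp: Suc_le_eq split: if_splits)
    \<comment> \<open>The last vertex but one sees \<open>last f\<close> in \<open>Z\<close>, so it
      already satisfies \<open>?T\<close> and would have to equal \<open>last f\<close>.\<close>
    define i where "i = length f - 2"
    have i: "Suc (Suc i) = length f" using len unfolding i_def by simp
    then have li: "f ! Suc i = last f"
      using ne by (metis diff_Suc_1 last_conv_nth)
    have "E (f ! i) (f ! Suc i)"
      using f(1) i unfolding induced_path_def by auto
    then have "f ! i = f ! Suc i" using f(6)[of "f ! i"] i l li by auto
    then show False using d i by (simp add: nth_eq_iff_index_eq)
  qed
  then show thesis using that[of f] f by blast
qed

subsection \<open>Induced cycles\<close>

definition seg :: "(nat \<Rightarrow> 'a) \<Rightarrow> nat \<Rightarrow> nat \<Rightarrow> 'a list" where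
  "seg w i j = map w [i..<Suc j]"

lemma set_seg [simp]: "set (seg w i j) = w ` {i..j}"
  unfolding seg_def by (auto simp: atLeastLessThanSuc_atLeastAtMost)

lemma length_seg [simp]: "length (seg w i j) = Suc j - i"
  unfolding seg_def by (simp del: upt_Suc)

lemma hd_seg [simp]: "i \<le> j \<Longrightarrow> hd (seg w i j) = w i"
  unfolding seg_def by (simp add: hd_map upt_rec)

lemma last_seg [simp]: "i \<le> j \<Longrightarrow> last (seg w i j) = w j"
  unfolding seg_def by simp

lemma seg_Nil_iff [simp]: "seg w i j = [] \<longleftrightarrow> j < i"
  unfolding seg_def by auto

text \<open>The cycle has m + 1 vertices. Its closing edge is a separate case rather than a modulus,
  so that subpaths and reversal become linear arithmetic on indices.\<close>

definition cycle_map :: "'a set \<Rightarrow> ('a \<Rightarrow> 'a \<Rightarrow> bool) \<Rightarrow> nat \<Rightarrow> (nat \<Rightarrow> 'a) \<Rightarrow> bool" where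
  "cycle_map V E m w \<longleftrightarrow> inj_on w {..m} \<and> w ` {..m} \<subseteq> V \<and>
     (\<forall>i\<le>m. \<forall>j\<le>m. E (w i) (w j) \<longleftrightarrow>
        j = Suc i \<or> i = Suc j \<or> i = 0 \<and> j = m \<or> j = 0 \<and> i = m)"

text \<open>The last assumption excludes only the segment from 0 to \<open>m\<close>, whose ends are
  joined by the closing edge.\<close>

lemma cycle_map_seg:
  assumes c: "cycle_map V E m w" and ij: "i \<le> j" "j \<le> m" and "0 < i \<or> j < m"
  shows "induced_path V E (seg w i j)"
proof -
  have nth: "seg w i j ! k = w (i + k)" if "k < Suc j - i" for k
    using that unfolding seg_def by (simp del: upt_Suc)
  have "E (w (i + k)) (w (i + l)) \<longleftrightarrow> l = Suc k \<or> k = Suc l"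
    if "k < Suc j - i" "l < Suc j - i" for k l
  proof -
    have "i + k \<le> m" "i + l \<le> m" using that ij by auto
    then have "E (w (i + k)) (w (i + l)) \<longleftrightarrow>
        i + l = Suc (i + k) \<or> i + k = Suc (i + l) \<or> i + k = 0 \<and> i + l = m \<or> i + l = 0 \<and> i + k = m"
      using c unfolding cycle_map_def by blast
    then show ?thesis using that ij assms(4) by auto
  qed
  moreover have "distinct (seg w i j)"
    using c ij unfolding cycle_map_def seg_def distinct_map
    by (auto simp del: upt_Suc intro: inj_on_subset)
  ultimately show ?thesis
    using c ij unfolding induced_path_def cycle_map_def by (auto simp: nth)
qed

lemma cycle_map_rev:
  assumes "cycle_map V E m w"
  shows "cycle_map V E m (\<lambda>i. w (m - i))"
proof -
  have "E (w (m - i)) (w (m - j)) \<longleftrightarrow> j = Suc i \<or> i = Suc j \<or> i = 0 \<and> j = m \<or> j = 0 \<and> i = m"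
    if "i \<le> m" "j \<le> m" for i j
  proof -
    have "E (w (m - i)) (w (m - j)) \<longleftrightarrow> m - j = Suc (m - i) \<or> m - i = Suc (m - j) \<or>
        m - i = 0 \<and> m - j = m \<or> m - j = 0 \<and> m - i = m"
      using assms unfolding cycle_map_def by (meson diff_le_self)
    then show ?thesis using that by linarith
  qed
  moreover have "inj_on (\<lambda>i. w (m - i)) {..m}"
  proof (rule inj_onI)
    fix x y assume "x \<in> {..m}" "y \<in> {..m}" "w (m - x) = w (m - y)"
    then have "m - x = m - y"
      using assms unfolding cycle_map_def by (meson atMost_iff diff_le_self inj_onD)
    then show "x = y" using \<open>x \<in> {..m}\<close> \<open>y \<in> {..m}\<close> by auto
  qed
  ultimately show ?thesis
    using assms unfolding cycle_map_def by (auto simp: image_subset_iff)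
qed

lemma is_hole_cycle_map:
  assumes h: "is_hole V E xs"
  shows "cycle_map V E (length xs - 1) (nth xs)"
proof -
  have n: "i \<le> length xs - 1 \<longleftrightarrow> i < length xs" for i
    using h unfolding is_hole_def by auto
  show ?thesis
    unfolding cycle_map_def n atMost_def
    using is_hole_nth_edge[OF h] h unfolding is_hole_def
    by (auto intro: inj_on_nth simp: n)
qed

text \<open>The number \<open>k\<close> is the sum of the gaps between consecutive elements of
  \<open>S\<close> up to \<open>k\<close>. A gap other than 1 is even, so only unit gaps affect the
  parity. For the positions of rim neighbors of a hub, a unit gap is a rim edge that the hub
  sees.\<close>

lemma even_iff_even_card_unit_gaps:
  fixes S :: "nat set"
  assumes "0 \<in> S"
    and gap: "\<And>i j. i \<in> S \<Longrightarrow> j \<in> S \<Longrightarrow> i < j \<Longrightarrow> j \<le> N \<Longrightarrow> (\<And>k. i < k \<Longrightarrow> k < j \<Longrightarrow> k \<notin> S)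
      \<Longrightarrow> j = Suc i \<or> even (j - i)"
    and "k \<in> S" "k \<le> N"
  shows "even k \<longleftrightarrow> even (card {i. i < k \<and> i \<in> S \<and> Suc i \<in> S})"
  using assms(3,4)
proof (induction k rule: less_induct)
  case (less k)
  show ?case
  proof (cases "k = 0")
    case False
    \<comment> \<open>The predecessor of \<open>k\<close> in \<open>S\<close>; passing from it to
      \<open>k\<close> adds exactly one gap.\<close>
    define i where "i = Max (S \<inter> {..<k})"
    have fin: "finite (S \<inter> {..<k})" "S \<inter> {..<k} \<noteq> {}"
      using \<open>0 \<in> S\<close> False by auto
    have i: "i \<in> S" "i < k" using Max_in[OF fin] unfolding i_def by auto
    have btw: "l \<notin> S" if "i < l" "l < k" for l
    proof
      assume "l \<in> S"
      then have "l \<le> i" unfolding i_def using fin that by (intro Max_ge) auto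
      then show False using that by simp
    qed
    have IH: "even i \<longleftrightarrow> even (card {l. l < i \<and> l \<in> S \<and> Suc l \<in> S})"
      using less i by simp
    have split: "{l. l < k \<and> l \<in> S \<and> Suc l \<in> S} =
        {l. l < i \<and> l \<in> S \<and> Suc l \<in> S} \<union> (if k = Suc i then {i} else {})"
    proof (intro set_eqI iffI)
      fix l assume l: "l \<in> {l. l < k \<and> l \<in> S \<and> Suc l \<in> S}"
      then have "l \<le> i" using btw[of l] by (intro leI) auto
      moreover have "k = Suc i" if "l = i"
        using l btw[of "Suc i"] that i by (cases "Suc i = k") auto
      ultimately show "l \<in> {l. l < i \<and> l \<in> S \<and> Suc l \<in> S} \<union> (if k = Suc i then {i} else {})"
        using l by (cases "l = i") auto
    next
      fix l assume "l \<in> {l. l < i \<and> l \<in> S \<and> Suc l \<in> S} \<union> (if k = Suc i then {i} else {})"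
      then show "l \<in> {l. l < k \<and> l \<in> S \<and> Suc l \<in> S}"
        using i less.prems by (auto split: if_splits)
    qed
    show ?thesis
    proof (cases "k = Suc i")
      case True
      then show ?thesis unfolding split using IH by simp
    next
      case False
      then have "even (k - i)" using gap[of i k] i less.prems btw by blast
      then show ?thesis unfolding split using IH False i by auto
    qed
  qed simp
qed

text \<open>Perfection enters the argument only through the parity of holes.\<close>

locale prism_C4_odd_hole_free =
  fixes V :: "'a set" and E :: "'a \<Rightarrow> 'a \<Rightarrow> bool"
  assumes graph: "sgraph V E" and C4_free: "C4_free V E" and prism_free: "prism_free V E"
    and hole_even: "is_hole V E xs \<Longrightarrow> even (length xs)"
begin

lemmas edge_sym = sgraph_sym[OF graph]
lemmas edge_irrefl [simp] = sgraph_irrefl[OF graph]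
lemmas path_Cons = induced_path_Cons[OF graph]
lemmas path_snoc = induced_path_snoc[OF graph]
lemmas path_append = induced_path_append[OF graph]

text \<open>The vertex \<open>x\<close> closes \<open>p\<close> to a hole with one more vertex,
  which is even and not a square. The parity contradictions below compare instances of this for
  different paths.\<close>

lemma closed_path_length:
  assumes "induced_path V E p" and "3 \<le> length p" and "x \<in> V" and "x \<notin> set p"
    and "\<And>y. y \<in> set p \<Longrightarrow> E x y \<longleftrightarrow> y = hd p \<or> y = last p"
  shows "odd (length p)" and "5 \<le> length p"
proof -
  have h: "is_hole V E (x # p)" using is_hole_Cons[OF graph] assms by blast
  then show odd: "odd (length p)" using hole_even[OF h] by simp
  have "length p \<noteq> 3" using h C4_free unfolding C4_free_def by force
  moreover have "length p \<noteq> 4" using odd by auto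
  ultimately show "5 \<le> length p" using assms(2) by linarith
qed

lemma no_square:
  assumes "E x y" "E y z" "E z t" "E t x" "\<not> E x z" "\<not> E y t" "x \<noteq> z" "y \<noteq> t"
  shows False
proof -
  have V: "x \<in> V" "y \<in> V" "z \<in> V" "t \<in> V"
    using assms sgraph_in[OF graph] by blast+
  have ne: "x \<noteq> y" "y \<noteq> z" "z \<noteq> t" "t \<noteq> x" using assms edge_irrefl by metis+
  have "induced_path V E [y, z, t]"
    by (intro path_Cons induced_path_single[OF graph]) (use V ne assms in auto)
  then show False
    using closed_path_length(2)[of "[y, z, t]" x] V ne assms edge_sym[of x t] by auto
qed

end

subsection \<open>Two hubs adjacent to both ends of a rim edge\<close>

text \<open>The rim has n + 2 vertices, and its closing edge from \<open>w (Suc n)\<close> to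
  \<open>w 0\<close> is the one whose ends both hubs see; indices 1 to \<open>n\<close> are inner.
  In the application \<open>w 0\<close>, \<open>w 1\<close>, \<open>w n\<close>,
  \<open>w (Suc n)\<close> are v, p, q, u.\<close>

locale two_hubs = prism_C4_odd_hole_free +
  fixes n :: nat and w :: "nat \<Rightarrow> 'a" and a b :: 'a
  assumes cyc: "cycle_map V E (Suc n) w" and n2: "2 \<le> n"
    and aV: "a \<in> V" and bV: "b \<in> V"
    and a_off: "a \<notin> w ` {..Suc n}" and b_off: "b \<notin> w ` {..Suc n}"
    and ab: "a \<noteq> b" "\<not> E a b"
    and a_ends: "E a (w 0)" "E a (w (Suc n))" and b_ends: "E b (w 0)" "E b (w (Suc n))"
begin

lemma swapped: "two_hubs V E n w b a"
  using two_hubs_axioms unfolding two_hubs_def two_hubs_axioms_def by (auto simp: edge_sym[of b a])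

lemma reversed: "two_hubs V E n (\<lambda>i. w (Suc n - i)) a b"
  using two_hubs_axioms cycle_map_rev[OF cyc]
  unfolding two_hubs_def two_hubs_axioms_def by auto

lemma wV: "i \<le> Suc n \<Longrightarrow> w i \<in> V"
  using cyc unfolding cycle_map_def by auto

lemma w_eq: "i \<le> Suc n \<Longrightarrow> j \<le> Suc n \<Longrightarrow> w i = w j \<longleftrightarrow> i = j"
  using cyc unfolding cycle_map_def by (auto dest: inj_onD)

lemma w_edge: "i \<le> Suc n \<Longrightarrow> j \<le> Suc n \<Longrightarrow>
    E (w i) (w j) \<longleftrightarrow> j = Suc i \<or> i = Suc j \<or> i = 0 \<and> j = Suc n \<or> j = 0 \<and> i = Suc n"
  using cyc unfolding cycle_map_def by blast

lemma a_neq: "i \<le> Suc n \<Longrightarrow> a \<noteq> w i" and b_neq: "i \<le> Suc n \<Longrightarrow> b \<noteq> w i"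
  using a_off b_off by auto

lemmas path_seg = cycle_map_seg[OF cyc]

lemma even_n: "even n" and n4: "4 \<le> n"
proof -
  have "induced_path V E (seg w 1 (Suc n))" using path_seg n2 by simp
  moreover have "E (w 0) y \<longleftrightarrow> y = w 1 \<or> y = w (Suc n)" if "y \<in> w ` {1..Suc n}" for y
    using that n2 by (auto simp: w_edge w_eq)
  moreover have "w 0 \<notin> w ` {1..Suc n}" by (auto simp: w_eq)
  ultimately have "odd (Suc n)" "5 \<le> Suc n"
    using closed_path_length[of "seg w 1 (Suc n)" "w 0"] n2 wV[of 0] by auto
  then show "even n" "4 \<le> n" by auto
qed

lemma a_off_seg: "j \<le> Suc n \<Longrightarrow> a \<notin> w ` {i..j}" and b_off_seg: "j \<le> Suc n \<Longrightarrow> b \<notin> w ` {i..j}"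
  using a_off b_off by auto

text \<open>Together with the nonadjacent hubs and \<open>w 0\<close> such a vertex forms a square
  unless it sees \<open>w 0\<close>; likewise for \<open>w (Suc n)\<close>. No inner vertex sees
  both.\<close>

lemma no_common_nbr:
  assumes "1 \<le> i" "i \<le> n" "E a (w i)" "E b (w i)"
  shows False
proof -
  have "E (w i) b" "E (w 0) a" "E (w (Suc n)) a"
    using assms a_ends edge_sym by blast+
  then have "E (w i) (w 0)" "E (w i) (w (Suc n))"
    using no_square[of a "w i" b "w 0"] no_square[of a "w i" b "w (Suc n)"]
      assms ab a_ends b_ends by (auto simp: w_eq)
  then show False using assms n2 by (auto simp: w_edge)
qed

text \<open>A long sector closes with \<open>a\<close> to a hole with j - i + 2 vertices. The third
  assumption excludes the whole rim path, whose ends are adjacent.\<close>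

lemma hub_gap:
  assumes "i < j" "j \<le> Suc n" "0 < i \<or> j < Suc n" "E a (w i)" "E a (w j)"
    and "\<And>k. i < k \<Longrightarrow> k < j \<Longrightarrow> \<not> E a (w k)"
  shows "j = Suc i \<or> even (j - i)"
proof (cases "j = Suc i")
  case False
  have "E a y \<longleftrightarrow> y = w i \<or> y = w j" if "y \<in> w ` {i..j}" for y
    using that assms by (auto simp: w_eq le_less)
  moreover have "a \<notin> w ` {i..j}" using a_off_seg assms by blast
  ultimately have "odd (Suc j - i)"
    using closed_path_length(1)[OF path_seg[of i j], of a] assms aV False by auto
  then show ?thesis using assms by (simp add: Suc_diff_le)
qed simp

text \<open>The segment with \<open>a\<close> and \<open>b\<close> at its ends is an induced path
  with j - i + 3 vertices, closed to an even hole by an end of the closing edge that misses the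
  segment. Such an end is lacking only if the segment is all of 1 to \<open>n\<close>, and then the
  pattern that \<open>l\<close> refutes would hold.\<close>

lemma hubs_gap:
  assumes "1 \<le> i" "i < j" "j \<le> n" "E a (w i)" "E b (w j)"
    and btw: "\<And>k. i < k \<Longrightarrow> k < j \<Longrightarrow> \<not> E a (w k) \<and> \<not> E b (w k)"
    and ex: "l \<in> {1..n}" "\<not> ((E a (w l) \<longleftrightarrow> l = 1) \<and> (E b (w l) \<longleftrightarrow> l = n))"
  shows "even (j - i)"
proof -
  have "i \<noteq> 1 \<or> j \<noteq> n"
  proof (rule ccontr)
    assume "\<not> (i \<noteq> 1 \<or> j \<noteq> n)"
    then have ij: "i = 1" "j = n" by auto
    then have "\<not> E b (w 1)" "\<not> E a (w n)"
      using no_common_nbr[of i] no_common_nbr[of j] assms by auto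
    then show False using ex btw[of l] assms n2 unfolding ij by (cases "l = 1"; cases "l = n") auto
  qed
  have Ea: "E a y \<longleftrightarrow> y = w i" if "y \<in> w ` {i..j}" for y
    using that assms no_common_nbr[of j] by (auto simp: w_eq le_less)
  have Eb: "E b y \<longleftrightarrow> y = w j" if "y \<in> w ` {i..j}" for y
    using that assms no_common_nbr[of i] by (auto simp: w_eq le_less)
  have off: "a \<notin> w ` {i..j}" "b \<notin> w ` {i..j}" using a_off_seg[of j i] b_off_seg[of j i] assms by simp_all
  have P: "induced_path V E (a # seg w i j @ [b])"
  proof (intro path_Cons path_snoc path_seg)
    show "E a y \<longleftrightarrow> y = hd (seg w i j @ [b])" if "y \<in> set (seg w i j @ [b])" for y
      using that Ea ab assms b_neq[of i] by auto
    show "E y b \<longleftrightarrow> y = last (seg w i j)" if "y \<in> set (seg w i j)" for y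
      using that Eb assms by (simp add: edge_sym[of y b])
  qed (use assms off ab aV bV in auto)
  obtain t where t: "t = 0 \<or> t = Suc n" "\<And>k. i \<le> k \<Longrightarrow> k \<le> j \<Longrightarrow> \<not> E (w t) (w k) \<and> w t \<noteq> w k"
  proof (cases "i = 1")
    case True
    then have "j < n" using assms \<open>i \<noteq> 1 \<or> j \<noteq> n\<close> by auto
    then show ?thesis using that[of "Suc n"] assms(1) by (auto simp: w_edge w_eq)
  next
    case False
    then show ?thesis using that[of 0] assms by (auto simp: w_edge w_eq)
  qed
  have "odd (length (a # seg w i j @ [b]))"
  proof (rule closed_path_length[OF P, of "w t"])
    show "w t \<in> V" using t wV by auto
    show "w t \<notin> set (a # seg w i j @ [b])" using t a_neq b_neq by fastforce
    show "E (w t) y \<longleftrightarrow> y = hd (a # seg w i j @ [b]) \<or> y = last (a # seg w i j @ [b])"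
      if "y \<in> set (a # seg w i j @ [b])" for y
      using that t a_ends b_ends edge_sym[of "w t" a] edge_sym[of "w t" b] by fastforce
  qed (use assms in auto)
  then show ?thesis using assms by (auto simp: Suc_diff_le)
qed

text \<open>Every long sector of the wheel at a hub is even and the rim path from \<open>w 0\<close> to
  \<open>w (Suc n)\<close> is odd, so each hub with an inner neighbor sees an odd number of rim edges.
  Gaps between neighbors of different hubs are even, so the union of the two neighborhoods
  must contain an odd number of rim edges as well, although it contains precisely those
  seen by one of the hubs.\<close>
lemma inner_nbrs_cases:
  shows "(\<forall>i\<in>{1..n}. \<not> E a (w i)) \<or> (\<forall>i\<in>{1..n}. \<not> E b (w i)) \<or>
    (\<forall>i\<in>{1..n}. (E a (w i) \<longleftrightarrow> i = 1) \<and> (E b (w i) \<longleftrightarrow> i = n)) \<or>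
    (\<forall>i\<in>{1..n}. (E b (w i) \<longleftrightarrow> i = 1) \<and> (E a (w i) \<longleftrightarrow> i = n))"
    (is "?C1 \<or> ?C2 \<or> ?C3 \<or> ?C4")
proof (rule ccontr)
  assume "\<not> ?thesis"
  then have neg: "\<not> ?C1" "\<not> ?C2" "\<not> ?C3" "\<not> ?C4" by blast+
  interpret swap: two_hubs V E n w b a by (rule swapped)
  let ?A = "{i. i \<le> Suc n \<and> E a (w i)}" and ?B = "{i. i \<le> Suc n \<and> E b (w i)}"
  obtain i0 where i0: "1 \<le> i0" "i0 \<le> n" "E a (w i0)" using neg(1) by auto
  \<comment> \<open>Witnesses against the two crossed patterns: \<open>k1\<close> serves gaps from
    \<open>a\<close> to \<open>b\<close>, and \<open>k2\<close> serves gaps from \<open>b\<close> to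
    \<open>a\<close>.\<close>
  obtain k1 where k1: "k1 \<in> {1..n}" "\<not> ((E a (w k1) \<longleftrightarrow> k1 = 1) \<and> (E b (w k1) \<longleftrightarrow> k1 = n))"
    using neg(3) unfolding Ball_def by (auto simp only: not_all not_imp)
  obtain k2 where k2: "k2 \<in> {1..n}" "\<not> ((E b (w k2) \<longleftrightarrow> k2 = 1) \<and> (E a (w k2) \<longleftrightarrow> k2 = n))"
    using neg(4) unfolding Ball_def by (auto simp only: not_all not_imp)
  obtain j0 where j0: "1 \<le> j0" "j0 \<le> n" "E b (w j0)" using neg(2) by auto
  have ends: "0 \<in> ?A" "0 \<in> ?B" "Suc n \<in> ?A" "Suc n \<in> ?B" using a_ends b_ends by auto
  have gA: "j = Suc i \<or> even (j - i)"
    if "i \<in> ?A" "j \<in> ?A" "i < j" "\<And>k. i < k \<Longrightarrow> k < j \<Longrightarrow> k \<notin> ?A" for i j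
  proof (rule hub_gap)
    \<comment> \<open>An inner neighbor of \<open>a\<close> prevents a gap from spanning all of 0 to
      \<open>Suc n\<close>.\<close>
    show "0 < i \<or> j < Suc n" using that i0 by (cases "i = 0") force+
  qed (use that in auto)
  have gB: "j = Suc i \<or> even (j - i)"
    if "i \<in> ?B" "j \<in> ?B" "i < j" "\<And>k. i < k \<Longrightarrow> k < j \<Longrightarrow> k \<notin> ?B" for i j
  proof (rule swap.hub_gap)
    show "0 < i \<or> j < Suc n" using that j0 by (cases "i = 0") force+
  qed (use that in auto)
  have gAB: "even (j - i)"
    if "i \<in> ?A" "i \<notin> ?B" "j \<in> ?B" "j \<notin> ?A" "i < j" "\<And>k. i < k \<Longrightarrow> k < j \<Longrightarrow> k \<notin> ?A \<union> ?B" for i j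
  proof (rule hubs_gap[OF _ _ _ _ _ _ k1])
    show "1 \<le> i" using that ends by (cases i) auto
    show "j \<le> n" using that ends by (cases "j = Suc n") auto
  qed (use that in auto)
  have gBA: "even (j - i)"
    if "i \<in> ?B" "i \<notin> ?A" "j \<in> ?A" "j \<notin> ?B" "i < j" "\<And>k. i < k \<Longrightarrow> k < j \<Longrightarrow> k \<notin> ?A \<union> ?B" for i j
  proof (rule swap.hubs_gap[OF _ _ _ _ _ _ k2])
    show "1 \<le> i" using that ends by (cases i) auto
    show "j \<le> n" using that ends by (cases "j = Suc n") auto
  qed (use that in auto)
  have gM: "j = Suc i \<or> even (j - i)"
    if ij: "i \<in> ?A \<union> ?B" "j \<in> ?A \<union> ?B" "i < j" "\<And>k. i < k \<Longrightarrow> k < j \<Longrightarrow> k \<notin> ?A \<union> ?B" for i j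
  proof -
    consider "i \<in> ?A" "j \<in> ?A" | "i \<in> ?B" "j \<in> ?B"
      | "i \<in> ?A" "i \<notin> ?B" "j \<in> ?B" "j \<notin> ?A" | "i \<in> ?B" "i \<notin> ?A" "j \<in> ?A" "j \<notin> ?B"
      using ij(1,2) by blast
    then show ?thesis
    proof cases
      case 1
      then show ?thesis using gA[OF _ _ ij(3)] ij(4) by blast
    next
      case 2
      then show ?thesis using gB[OF _ _ ij(3)] ij(4) by blast
    next
      case 3
      then show ?thesis using gAB[OF _ _ _ _ ij(3,4)] by blast
    next
      case 4
      then show ?thesis using gBA[OF _ _ _ _ ij(3,4)] by blast
    qed
  qed
  \<comment> \<open>\<open>u S\<close> records the edges of the rim path with both ends in
    \<open>S\<close> by their lower index. Its size will be odd because \<open>Suc n\<close> is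
    odd.\<close>
  define u where "u S = {i. i < Suc n \<and> i \<in> S \<and> Suc i \<in> S}" for S :: "nat set"
  have odd_units: "odd (card (u S))"
    if "0 \<in> S" "Suc n \<in> S" "\<And>i j. i \<in> S \<Longrightarrow> j \<in> S \<Longrightarrow> i < j \<Longrightarrow> j \<le> Suc n \<Longrightarrow>
      (\<And>k. i < k \<Longrightarrow> k < j \<Longrightarrow> k \<notin> S) \<Longrightarrow> j = Suc i \<or> even (j - i)" for S
    using even_iff_even_card_unit_gaps[of S "Suc n" "Suc n"] that even_n unfolding u_def by simp
  have "odd (card (u ?A))" using ends gA by (intro odd_units) blast+
  moreover have "odd (card (u ?B))" using ends gB by (intro odd_units) blast+
  moreover have "odd (card (u (?A \<union> ?B)))" using ends gM by (intro odd_units) blast+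
  moreover have "u (?A \<union> ?B) = u ?A \<union> u ?B"
  proof
    show "u ?A \<union> u ?B \<subseteq> u (?A \<union> ?B)" unfolding u_def by blast
    show "u (?A \<union> ?B) \<subseteq> u ?A \<union> u ?B"
    proof
      fix i assume i: "i \<in> u (?A \<union> ?B)"
      \<comment> \<open>Otherwise the ends would be seen by different hubs only, a gap of length 1
        where an even one is forced.\<close>
      show "i \<in> u ?A \<union> u ?B"
        using i gAB[of i "Suc i"] gBA[of i "Suc i"] unfolding u_def by auto
    qed
  qed
  moreover have "u ?A \<inter> u ?B = {}"
  proof (rule equals0I)
    \<comment> \<open>An edge seen by both hubs would have an inner end that is a common
      neighbor.\<close>
    fix i assume i: "i \<in> u ?A \<inter> u ?B"
    then have "i = 0" using no_common_nbr[of i] unfolding u_def by (cases i) auto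
    then show False using i no_common_nbr[of 1] n2 unfolding u_def by auto
  qed
  moreover have "finite (u S)" for S unfolding u_def by simp
  ultimately show False by (simp add: card_Un_disjoint)
qed

end

section \<open>Prisms, and hubs attached to a connected set\<close>

definition linked :: "('a \<Rightarrow> 'a \<Rightarrow> bool) \<Rightarrow> 'a list \<Rightarrow> 'a list \<Rightarrow> bool" where
  "linked E p q \<longleftrightarrow> set p \<inter> set q = {} \<and> E (hd p) (hd q) \<and> E (last p) (last q) \<and>
     (\<forall>x\<in>set p. \<forall>y\<in>set q. E x y \<longrightarrow> (x = hd p \<and> y = hd q) \<or> (x = last p \<and> y = last q))"

lemma linked_sym: "sgraph V E \<Longrightarrow> linked E p q \<Longrightarrow> linked E q p"
  unfolding linked_def sgraph_def by blast

lemma is_prismI: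
  assumes g: "sgraph V E"
    and "induced_path V E P1" "induced_path V E P2" "induced_path V E P3"
    and "distinct [hd P1, hd P2, hd P3, last P1, last P2, last P3]"
    and l: "linked E P1 P2" "linked E P1 P3" "linked E P2 P3"
  shows "is_prism V E P1 P2 P3"
proof -
  define P where "P = (\<lambda>i::nat. if i = 1 then P1 else if i = 2 then P2 else P3)"
  have "\<forall>i\<in>{1, 2, 3}. \<forall>j\<in>{1, 2, 3}. i \<noteq> j \<longrightarrow> linked E (P i) (P j)"
    using l l[THEN linked_sym[OF g]] unfolding P_def by simp
  moreover have "\<forall>i\<in>{1, 2, 3}. induced_path V E (P i)"
    using assms unfolding P_def by simp
  ultimately show ?thesis
    using assms(5) unfolding is_prism_def Let_def linked_def P_def by blast
qed

text \<open>\<open>K\<close> stands for the component of G - N[u] - N[v] containing the rest of the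
  original hole. Of the rim it is required to contain only indices 2 to n - 1: \<open>w 1\<close>
  and \<open>w n\<close> are neighbors of the ends of the closing edge and so lie outside.\<close>

locale attached_hubs = two_hubs +
  fixes K :: "'a set"
  assumes KV: "K \<subseteq> V" and K_con: "\<And>x y. x \<in> K \<Longrightarrow> y \<in> K \<Longrightarrow> connected_in E K x y"
    and K_inner: "\<And>i. 2 \<le> i \<Longrightarrow> i < n \<Longrightarrow> w i \<in> K"
    and K_ends: "\<And>x. x \<in> K \<Longrightarrow> \<not> E (w 0) x \<and> \<not> E (w (Suc n)) x"
    and a_nbr: "\<exists>x\<in>K. E a x" and b_nbr: "\<exists>x\<in>K. E b x"
begin

lemma swapped_attached: "attached_hubs V E n w b a K"
  using attached_hubs_axioms swapped
  unfolding attached_hubs_def attached_hubs_axioms_def by blast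

lemma reversed_attached: "attached_hubs V E n (\<lambda>i. w (Suc n - i)) a b K"
proof -
  have "w (Suc n - i) \<in> K" if "2 \<le> i" "i < n" for i
    by (rule K_inner) (use that in auto)
  then show ?thesis
    using attached_hubs_axioms reversed
    unfolding attached_hubs_def attached_hubs_axioms_def by auto
qed

lemma off_K: "a \<notin> K" "b \<notin> K" "w 0 \<notin> K" "w 1 \<notin> K" "w n \<notin> K" "w (Suc n) \<notin> K"
proof -
  have E: "E (w 0) a" "E (w 0) b" "E (w (Suc n)) (w 0)" "E (w 0) (w 1)" "E (w (Suc n)) (w n)"
    "E (w 0) (w (Suc n))"
    using a_ends b_ends edge_sym n2 by (auto simp: w_edge)
  show "a \<notin> K" "b \<notin> K" "w 0 \<notin> K" "w 1 \<notin> K" "w n \<notin> K" "w (Suc n) \<notin> K"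
    using E K_ends by blast+
qed

text \<open>A shortest path \<open>f\<close> in \<open>K\<close> from a neighbor of \<open>b\<close> to the rim makes a pyramid (hence an
  odd hole) or a prism with the triangle formed by \<open>b\<close> and the ends of the rim.\<close>
lemma inner_nbr_exists: "\<exists>i\<in>{1..n}. E b (w i)"
proof (rule ccontr)
  assume "\<not> ?thesis"
  then have none: "\<not> E b (w i)" if "1 \<le> i" "i \<le> n" for i using that by auto
  obtain x where x: "x \<in> K" "E b x" using b_nbr by blast
  have w2K: "w 2 \<in> K" using K_inner n4 by simp
  obtain f where f: "induced_path V E f" "set f \<subseteq> K" "set f \<inter> w ` {1..n} = {}" "E b (hd f)"
    "\<And>z. z \<in> set f \<Longrightarrow> E b z \<Longrightarrow> z = hd f" "\<exists>y\<in>w ` {1..n}. E (last f) y"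
    "\<And>z y. z \<in> set f \<Longrightarrow> y \<in> w ` {1..n} \<Longrightarrow> E z y \<Longrightarrow> z = last f"
    by (rule attaching_path[OF graph KV K_con[OF x(1) w2K], of "E b" "w ` {1..n}"])
      (use x none n4 in auto)
  have f_ne: "f \<noteq> []" using f(1) unfolding induced_path_def by simp
  then have f_len: "1 \<le> length f" by (simp add: Suc_le_eq)
  have f_off: "b \<notin> set f" "w 0 \<notin> set f" "w (Suc n) \<notin> set f" using f(2) off_K by auto
  have f_w: "w k \<notin> set f" if "1 \<le> k" "k \<le> n" for k using f(3) that by auto
  let ?J = "{k. 1 \<le> k \<and> k \<le> n \<and> E (last f) (w k)}"
  \<comment> \<open>The first and the last inner rim neighbor of \<open>last f\<close>; no other
    vertex of \<open>f\<close> sees the inner rim.\<close>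
  define i j where "i = Min ?J" and "j = Max ?J"
  have J: "finite ?J" "?J \<noteq> {}" using f(6) by auto
  have i: "1 \<le> i" "i \<le> n" "E (last f) (w i)" using Min_in[OF J] unfolding i_def by auto
  have j: "1 \<le> j" "j \<le> n" "E (last f) (w j)" using Max_in[OF J] unfolding j_def by auto
  have lo: "k = i" if "1 \<le> k" "k \<le> i" "E (last f) (w k)" for k
  proof -
    have "k \<in> ?J" using that i by auto
    from Min_le[OF J(1) this] show ?thesis using that unfolding i_def by auto
  qed
  have hi: "k = j" if "j \<le> k" "k \<le> n" "E (last f) (w k)" for k
  proof -
    have "k \<in> ?J" using that j by auto
    from Max_ge[OF J(1) this] show ?thesis using that unfolding j_def by auto
  qed
  have ij: "i \<le> j" using Min_le[OF J(1), of j] j unfolding i_def by auto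
  have lf: "last f \<in> set f" "hd f \<in> set f" using f_ne by auto
  have fi: "E y z \<longleftrightarrow> y = last f \<and> z = w i" if yz: "y \<in> set f" "z \<in> w ` {1..i}" for y z
  proof -
    obtain k where k: "z = w k" "k \<in> {1..i}" using yz(2) by blast
    have "y = last f \<and> k = i" if y: "E y z"
    proof -
      have "z \<in> w ` {1..n}" using k i j by auto
      then have "y = last f" using f(7) yz(1) y by blast
      then show ?thesis using y k lo[of k] i j by auto
    qed
    then show ?thesis using k i j by (auto simp: w_eq)
  qed
  have fj: "E y z \<longleftrightarrow> y = last f \<and> z = w j" if yz: "y \<in> set f" "z \<in> w ` {j..n}" for y z
  proof -
    obtain k where k: "z = w k" "k \<in> {j..n}" using yz(2) by blast
    have "y = last f \<and> k = j" if y: "E y z"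
    proof -
      have "z \<in> w ` {1..n}" using k i j by auto
      then have "y = last f" using f(7) yz(1) y by blast
      then show ?thesis using y k hi[of k] i j by auto
    qed
    then show ?thesis using k i j by (auto simp: w_eq)
  qed
  have Ebf: "E b y \<longleftrightarrow> y = hd f" if "y \<in> set f" for y using f(4,5) that by blast
  have bf: "induced_path V E (b # f)"
    by (rule path_Cons[OF bV f(1) f_off(1) Ebf])
  have E0f: "\<not> E (w 0) y" "\<not> E (w (Suc n)) y" if "y \<in> set f" for y
    using f(2) K_ends that by auto
  have E0b: "E (w 0) b" "E (w (Suc n)) b" using b_ends edge_sym by blast+
  \<comment> \<open>The hole runs through \<open>w 0\<close>, \<open>b\<close>, \<open>f\<close> and
    then from \<open>w i\<close> down to \<open>w 1\<close>.\<close>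
  have par1: "even (length f + i)"
  proof -
    let ?p = "(b # f) @ rev (seg w 1 i)"
    have "induced_path V E ?p"
    proof (rule path_append)
      show "E y z \<longleftrightarrow> y = last (b # f) \<and> z = hd (rev (seg w 1 i))"
        if "y \<in> set (b # f)" "z \<in> set (rev (seg w 1 i))" for y z
        using that fi[of y z] none f_ne f_off i lf(1) by (auto simp: hd_rev)
      show "set (b # f) \<inter> set (rev (seg w 1 i)) = {}"
        using f_w i b_off_seg[of i 1] by auto
    qed (use bf i in \<open>auto intro!: induced_path_rev path_seg\<close>)
    then have "odd (length ?p)"
    proof (rule closed_path_length)
      show "E (w 0) y \<longleftrightarrow> y = hd ?p \<or> y = last ?p" if "y \<in> set ?p" for y
        using that E0f E0b i by (auto simp: w_edge w_eq last_rev)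
      show "w 0 \<notin> set ?p" using f_off b_neq[of 0] i by (auto simp: w_eq)
    qed (use f_len i wV in auto)
    then show ?thesis using i by simp
  qed
  \<comment> \<open>The hole runs through \<open>w (Suc n)\<close>, \<open>b\<close>,
    \<open>f\<close> and then from \<open>w j\<close> up to \<open>w n\<close>.\<close>
  have par2: "even (length f + (n - j)) = False"
  proof -
    let ?p = "(b # f) @ seg w j n"
    have "induced_path V E ?p"
    proof (rule path_append)
      show "E y z \<longleftrightarrow> y = last (b # f) \<and> z = hd (seg w j n)"
        if "y \<in> set (b # f)" "z \<in> set (seg w j n)" for y z
        using that fj[of y z] none f_ne f_off j lf(1) by auto
      show "set (b # f) \<inter> set (seg w j n) = {}"
        using f_w j b_off_seg[of n j] by auto
    qed (use bf j path_seg in auto)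
    then have "odd (length ?p)"
    proof (rule closed_path_length)
      show "E (w (Suc n)) y \<longleftrightarrow> y = hd ?p \<or> y = last ?p" if "y \<in> set ?p" for y
        using that E0f E0b j by (auto simp: w_edge w_eq)
      show "w (Suc n) \<notin> set ?p" using f_off b_neq[of "Suc n"] j by (auto simp: w_eq)
    qed (use f_len j wV in auto)
    then show ?thesis using j by auto
  qed
  \<comment> \<open>For a single attachment the two parities would make \<open>n\<close>
    odd.\<close>
  have "j \<noteq> i" using par1 par2 even_n i by auto
  moreover have "j \<noteq> Suc i"
  proof
    assume ji: "j = Suc i"
    \<comment> \<open>The triangles are \<open>b\<close>, \<open>w 0\<close>,
      \<open>w (Suc n)\<close> and \<open>last f\<close>, \<open>w i\<close>, \<open>w j\<close>.
      Reversing \<open>?P3\<close> makes all three paths start in the first one.\<close>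
    let ?P1 = "b # f" and ?P2 = "seg w 0 i" and ?P3 = "rev (seg w j (Suc n))"
    have P: "induced_path V E ?P1" "induced_path V E ?P2" "induced_path V E ?P3"
      using bf path_seg[of 0 i] path_seg[of j "Suc n"] induced_path_rev i j by auto
    have h: "hd ?P1 = b" "hd ?P2 = w 0" "hd ?P3 = w (Suc n)"
      "last ?P1 = last f" "last ?P2 = w i" "last ?P3 = w j"
      using f_ne i j by (auto simp: hd_rev last_rev)
    have dist: "set ?P1 \<inter> set ?P2 = {}" "set ?P1 \<inter> set ?P3 = {}" "set ?P2 \<inter> set ?P3 = {}"
    proof -
      have "w k \<notin> set f" if "k \<le> Suc n" for k
        using that f_off f_w[of k] by (cases "k = 0"; cases "k = Suc n") auto
      then show "set ?P1 \<inter> set ?P2 = {}" "set ?P1 \<inter> set ?P3 = {}"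
        using i j b_off_seg[of i 0] b_off_seg[of "Suc n" j] by auto
      show "set ?P2 \<inter> set ?P3 = {}" using i j ji by (auto simp: w_eq)
    qed
    have c12: "x = b \<and> y = w 0 \<or> x = last f \<and> y = w i"
      if xy: "x \<in> set ?P1" "y \<in> set ?P2" "E x y" for x y
    proof -
      obtain k where k: "k \<le> i" "y = w k" using xy(2) by auto
      show ?thesis
      proof (cases "k = 0")
        case True
        then show ?thesis using xy k E0f[of x] edge_sym[of x "w 0"] by auto
      next
        case False
        then show ?thesis using xy k none[of k] fi[of x y] i by auto
      qed
    qed
    have c13: "x = b \<and> y = w (Suc n) \<or> x = last f \<and> y = w j"
      if xy: "x \<in> set ?P1" "y \<in> set ?P3" "E x y" for x y
    proof -
      obtain k where k: "j \<le> k" "k \<le> Suc n" "y = w k" using xy(2) by auto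
      show ?thesis
      proof (cases "k = Suc n")
        case True
        then show ?thesis using xy k E0f[of x] edge_sym[of x "w (Suc n)"] by auto
      next
        case False
        then show ?thesis using xy k none[of k] fj[of x y] j by auto
      qed
    qed
    have c23: "x = w 0 \<and> y = w (Suc n) \<or> x = w i \<and> y = w j"
      if xy: "x \<in> set ?P2" "y \<in> set ?P3" "E x y" for x y
      using xy i j ji by (auto simp: w_edge)
    have tri: "E b (w 0)" "E b (w (Suc n))" "E (w 0) (w (Suc n))"
      "E (last f) (w i)" "E (last f) (w j)" "E (w i) (w j)"
      using b_ends i j ji by (auto simp: w_edge)
    have "is_prism V E ?P1 ?P2 ?P3"
    proof (rule is_prismI[OF graph P])
      show "distinct [hd ?P1, hd ?P2, hd ?P3, last ?P1, last ?P2, last ?P3]"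
        unfolding h using i j ji f_off f_w lf b_neq
        by (auto simp: w_eq)
      show "linked E ?P1 ?P2" unfolding linked_def h using dist tri c12 by blast
      show "linked E ?P1 ?P3" unfolding linked_def h using dist tri c13 by blast
      show "linked E ?P2 ?P3" unfolding linked_def h using dist tri c23 by blast
    qed
    then show False using prism_free unfolding prism_free_def by blast
  qed
  ultimately have gap: "Suc i < j" using ij by auto
  \<comment> \<open>Replacing the rim between \<open>w i\<close> and \<open>w j\<close> by
    \<open>last f\<close> gives a third hole. Its parity contradicts the sum of \<open>par1\<close>
    and \<open>par2\<close>.\<close>
  have "even (i + (n - j))"
  proof -
    let ?p = "(seg w 1 i @ [last f]) @ seg w j (Suc n)"
    have lfE: "E x (last f) \<longleftrightarrow> x = w i" if "x \<in> w ` {1..i}" for x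
      using fi[OF lf(1) that] edge_sym[of x "last f"] by simp
    have "induced_path V E ?p"
    proof (rule path_append)
      show "induced_path V E (seg w 1 i @ [last f])"
      proof (rule path_snoc)
        show "induced_path V E (seg w 1 i)" using i by (intro path_seg) auto
        show "E y (last f) \<longleftrightarrow> y = last (seg w 1 i)" if "y \<in> set (seg w 1 i)" for y
          using that lfE[of y] i(1) by simp
        show "last f \<notin> set (seg w 1 i)" using f(3) lf(1) i by auto
        show "last f \<in> V" using f(2) lf(1) KV by auto
      qed
      show "set (seg w 1 i @ [last f]) \<inter> set (seg w j (Suc n)) = {}"
        using gap i j f_w f_off lf by (auto simp: w_eq le_Suc_eq)
      show "E x y \<longleftrightarrow> x = last (seg w 1 i @ [last f]) \<and> y = hd (seg w j (Suc n))"
        if xy: "x \<in> set (seg w 1 i @ [last f])" "y \<in> set (seg w j (Suc n))" for x y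
      proof -
        obtain k where k: "y = w k" "j \<le> k" "k \<le> Suc n" using xy(2) by auto
        show ?thesis
        proof (cases "x = last f")
          case True
          then show ?thesis
            using k fj[OF lf(1), of y] E0f[OF lf(1)] j edge_sym[of "last f" "w (Suc n)"]
            by (cases "k = Suc n") (auto simp: w_eq)
        next
          case False
          then obtain l where "x = w l" "1 \<le> l" "l \<le> i" using xy(1) by auto
          then show ?thesis using False k gap i j by (auto simp: w_edge)
        qed
      qed
    qed (use j path_seg in auto)
    then have "odd (length ?p)"
    proof (rule closed_path_length)
      show "E (w 0) y \<longleftrightarrow> y = hd ?p \<or> y = last ?p" if "y \<in> set ?p" for y
        using that E0f[OF lf(1)] f_w[of 1] lf f_off i j n4 by (auto simp: w_edge w_eq hd_append)
      show "w 0 \<notin> set ?p" using f_off lf i j by (auto simp: w_eq)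
    qed (use i j wV in auto)
    then show ?thesis using j i by auto
  qed
  then show False using par1 par2 by auto
qed

text \<open>The rim vertices \<open>w 0\<close> and \<open>w (Suc n)\<close> close \<open>a, f, w j, \<dots>, w n\<close> to holes of different
  parity, as \<open>w 0\<close> only does so through \<open>b\<close>.\<close>
lemma no_path_off_b:
  assumes pat: "\<And>i. 1 \<le> i \<Longrightarrow> i \<le> n \<Longrightarrow> (E a (w i) \<longleftrightarrow> i = 1) \<and> (E b (w i) \<longleftrightarrow> i = n)"
    and g: "induced_path V E g" "set g \<subseteq> K" "set g \<inter> w ` {2..n} = {}" "E a (hd g)"
    and gb: "\<And>z. z \<in> set g \<Longrightarrow> \<not> E b z" and gw: "\<exists>i\<in>{2..n}. E (last g) (w i)"
  shows False
proof -
  have g_ne: "g \<noteq> []" using g(1) unfolding induced_path_def by simp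
  have walk: "successively E g"
    using g(1) unfolding induced_path_def successively_conv_nth by auto
  have gV: "set g \<subseteq> V" using g(2) KV by blast
  \<comment> \<open>Vertices of \<open>g\<close> before its end may see \<open>w n\<close>, so the
    path is shortened once more, inside \<open>set g\<close>, until only its last vertex sees
    indices 2 to \<open>n\<close>.\<close>
  obtain f where f: "induced_path V E f" "set f \<subseteq> set g" "E a (hd f)" "\<exists>i\<in>{2..n}. E (last f) (w i)"
    "\<And>z. z \<in> set f \<Longrightarrow> E a z \<Longrightarrow> z = hd f"
    "\<And>z. z \<in> set f \<Longrightarrow> (\<exists>i\<in>{2..n}. E z (w i)) \<Longrightarrow> z = last f"
    by (rule shortest_path[OF graph gV g_ne walk order_refl, of "E a" "\<lambda>z. \<exists>i\<in>{2..n}. E z (w i)"])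
      (use g gw in auto)
  have f_ne: "f \<noteq> []" using f(1) unfolding induced_path_def by simp
  then have f_len: "1 \<le> length f" by (simp add: Suc_le_eq)
  have f_off: "a \<notin> set f" "b \<notin> set f" "w 0 \<notin> set f" "w (Suc n) \<notin> set f"
    using f(2) g(2) off_K by auto
  have f_w: "w k \<notin> set f" if "2 \<le> k" "k \<le> n" for k using f(2) g(3) that by auto
  \<comment> \<open>Index 1 is left out so that \<open>w 1\<close>, the inner rim neighbor of
    \<open>a\<close>, stays off the path.\<close>
  let ?J = "{k. 2 \<le> k \<and> k \<le> n \<and> E (last f) (w k)}"
  define j where "j = Max ?J"
  have J: "finite ?J" "?J \<noteq> {}" using f(4) by auto
  have j: "2 \<le> j" "j \<le> n" "E (last f) (w j)" using Max_in[OF J] unfolding j_def by auto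
  have hi: "k = j" if "j \<le> k" "k \<le> n" "E (last f) (w k)" for k
  proof -
    have "k \<in> ?J" using that j by auto
    from Max_ge[OF J(1) this] show ?thesis using that unfolding j_def by auto
  qed
  have fj: "E y z \<longleftrightarrow> y = last f \<and> z = w j" if yz: "y \<in> set f" "z \<in> w ` {j..n}" for y z
  proof -
    obtain k where k: "z = w k" "j \<le> k" "k \<le> n" using yz(2) by auto
    have "y = last f \<and> k = j" if y: "E y z"
    proof -
      have "\<exists>i\<in>{2..n}. E y (w i)" using y k j by (intro bexI[of _ k]) auto
      then have "y = last f" using f(6)[OF yz(1)] by blast
      then show ?thesis using y k hi[of k] by auto
    qed
    then show ?thesis using k j by (auto simp: w_eq)
  qed
  have E0f: "\<not> E (w 0) y" "\<not> E (w (Suc n)) y" "\<not> E b y" if "y \<in> set f" for y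
    using f(2) g(2) gb K_ends that by auto
  have E0: "E (w 0) a" "E (w 0) b" "E (w (Suc n)) a" using a_ends b_ends edge_sym by blast+
  let ?q = "f @ seg w j n"
  have q: "induced_path V E ?q"
  proof (rule path_append)
    show "E y z \<longleftrightarrow> y = last f \<and> z = hd (seg w j n)"
      if "y \<in> set f" "z \<in> set (seg w j n)" for y z
      using that fj[of y z] j by auto
    show "set f \<inter> set (seg w j n) = {}" using f_w j by auto
  qed (use f j path_seg in auto)
  have P: "induced_path V E (a # ?q)"
  proof (rule path_Cons)
    show "E a y \<longleftrightarrow> y = hd ?q" if "y \<in> set ?q" for y
      using that f(3,5) pat f_ne f_w j by (fastforce simp: hd_append)
    show "a \<notin> set ?q" using f_off a_off_seg[of n j] by auto
  qed (use q aV in auto)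
  have "odd (length (a # ?q))"
  proof (rule closed_path_length[OF P])
    show "E (w (Suc n)) y \<longleftrightarrow> y = hd (a # ?q) \<or> y = last (a # ?q)" if "y \<in> set (a # ?q)" for y
      using that E0f E0 j a_neq[of n] by (auto simp: w_edge w_eq)
    show "w (Suc n) \<notin> set (a # ?q)" using f_off a_neq[of "Suc n"] j by (auto simp: w_eq)
  qed (use f_len j wV in auto)
  \<comment> \<open>By \<open>pat\<close> the only neighbor of \<open>b\<close> on the previous path
    is its end \<open>w n\<close>, so \<open>b\<close> lengthens it by one.\<close>
  moreover have P': "induced_path V E ((a # ?q) @ [b])"
  proof (rule path_snoc[OF bV P])
    show "E y b \<longleftrightarrow> y = last (a # ?q)" if "y \<in> set (a # ?q)" for y
      using that E0f ab pat j f_ne a_neq[of n] f_w[of n] n2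
      by (auto simp: edge_sym[of _ b] w_eq)
    show "b \<notin> set (a # ?q)" using f_off b_off_seg[of n j] ab by auto
  qed
  have "odd (length ((a # ?q) @ [b]))"
  proof (rule closed_path_length[OF P'])
    show "E (w 0) y \<longleftrightarrow> y = hd ((a # ?q) @ [b]) \<or> y = last ((a # ?q) @ [b])"
      if "y \<in> set ((a # ?q) @ [b])" for y
      using that E0f E0 j by (auto simp: w_edge w_eq)
    show "w 0 \<notin> set ((a # ?q) @ [b])" using f_off a_neq[of 0] b_neq[of 0] j by (auto simp: w_eq)
  qed (use f_len j wV in auto)
  ultimately show False by simp
qed

text \<open>A shortest path in \<open>K\<close> from a neighbor of either hub to the middle of the
  rim starts at a vertex that sees exactly one hub, and its other vertices see neither. So it avoids
  the neighborhood of one hub entirely.\<close>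

lemma not_crossed_twins:
  assumes pat: "\<And>i. 1 \<le> i \<Longrightarrow> i \<le> n \<Longrightarrow> (E a (w i) \<longleftrightarrow> i = 1) \<and> (E b (w i) \<longleftrightarrow> i = n)"
  shows False
proof -
  \<comment> \<open>Reversal exchanges \<open>w 1\<close> and \<open>w n\<close>; swapping the hubs
    as well restores the pattern \<open>pat\<close>.\<close>
  interpret mirror: attached_hubs V E n "\<lambda>i. w (Suc n - i)" b a K
    using attached_hubs.swapped_attached[OF reversed_attached] .
  obtain x where x: "x \<in> K" "E a x" using a_nbr by blast
  have w2K: "w 2 \<in> K" using K_inner n4 by simp
  have w2: "w 2 \<in> w ` {2..n - 1}" using n4 by auto
  have none: "\<not> E a (w i) \<and> \<not> E b (w i)" if "2 \<le> i" "i \<le> n - 1" for i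
    using pat[of i] that n4 by auto
  obtain f where f: "induced_path V E f" "set f \<subseteq> K" "set f \<inter> w ` {2..n - 1} = {}"
    "E a (hd f) \<or> E b (hd f)" "\<And>z. z \<in> set f \<Longrightarrow> E a z \<or> E b z \<Longrightarrow> z = hd f"
    "\<exists>y\<in>w ` {2..n - 1}. E (last f) y"
    by (rule attaching_path[OF graph KV K_con[OF x(1) w2K], of "\<lambda>z. E a z \<or> E b z" "w ` {2..n - 1}"])
      (use x none w2 in auto)
  have f_w: "w k \<notin> set f" if "1 \<le> k" "k \<le> n" for k
  proof (cases "k = 1 \<or> k = n")
    case True
    then show ?thesis using f(2) off_K by auto
  next
    case False
    then show ?thesis using f(3) that by auto
  qed
  have not_both: "\<not> (E a z \<and> E b z)" if "z \<in> set f" for z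
  proof
    assume z: "E a z \<and> E b z"
    \<comment> \<open>Then \<open>a\<close>, \<open>z\<close>, \<open>b\<close>, \<open>w 0\<close>
      form a square.\<close>
    have "\<not> E z (w 0)" "z \<noteq> w 0"
      using that f(2) K_ends off_K edge_sym[of z "w 0"] by auto
    then show False
      using no_square[of a z b "w 0"] z ab b_ends a_ends edge_sym[of z b] edge_sym[of "w 0" a] by auto
  qed
  obtain l where l: "2 \<le> l" "l \<le> n - 1" "E (last f) (w l)" using f(6) by auto
  from f(4) show False
  proof
    assume fa: "E a (hd f)"
    show False
    proof (rule no_path_off_b[OF pat f(1,2) _ fa])
      show "\<not> E b z" if "z \<in> set f" for z using that fa f(5) not_both by blast
      show "\<exists>i\<in>{2..n}. E (last f) (w i)" using l by (intro bexI[of _ l]) auto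
      show "set f \<inter> w ` {2..n} = {}" using f_w by auto
    qed
  next
    assume fb: "E b (hd f)"
    show False
    proof (rule mirror.no_path_off_b[OF _ f(1,2) _ fb])
      show "(E b (w (Suc n - i)) \<longleftrightarrow> i = 1) \<and> (E a (w (Suc n - i)) \<longleftrightarrow> i = n)"
        if "1 \<le> i" "i \<le> n" for i using pat[of "Suc n - i"] that by auto
      show "\<not> E a z" if "z \<in> set f" for z using that fb f(5) not_both by blast
      show "\<exists>i\<in>{2..n}. E (last f) (w (Suc n - i))"
        using l by (intro bexI[of _ "Suc n - l"]) auto
      show "set f \<inter> (\<lambda>i. w (Suc n - i)) ` {2..n} = {}" using f_w by auto
    qed
  qed
qed

text \<open>The attachments to \<open>K\<close> give each hub an inner neighbor, leaving the two
  crossed patterns, which are mirror images.\<close>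

lemma impossible: False
proof -
  interpret swap: attached_hubs V E n w b a K by (rule swapped_attached)
  show False
    using inner_nbrs_cases inner_nbr_exists swap.inner_nbr_exists
      not_crossed_twins swap.not_crossed_twins by auto
qed

end

section \<open>Closing two attachments to a rim\<close>

context prism_C4_odd_hole_free
begin

text \<open>A shortest path \<open>f\<close> in \<open>K\<close> from a neighbor of \<open>p\<close>
  to a neighbor of \<open>q\<close> yields the hole v, p, f, q, u. It is the rim of the preceding
  locale, with hubs \<open>a\<close> and \<open>b\<close>.\<close>

lemma no_twin_attachments:
  assumes E: "E u v" "E a u" "E a v" "E b u" "E b v" "\<not> E a b" "a \<noteq> b"
    and K: "K \<subseteq> V" "\<And>x y. x \<in> K \<Longrightarrow> y \<in> K \<Longrightarrow> connected_in E K x y"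
      "\<And>x. x \<in> K \<Longrightarrow> \<not> E u x \<and> \<not> E v x"
      "\<exists>x\<in>K. E a x" "\<exists>x\<in>K. E b x"
    and p: "E v p" "\<not> E u p" "p \<noteq> u" "\<exists>x\<in>K. E p x"
    and q: "E u q" "\<not> E v q" "q \<noteq> v" "\<exists>x\<in>K. E q x"
  shows False
proof -
  have V: "u \<in> V" "v \<in> V" "a \<in> V" "b \<in> V" "p \<in> V" "q \<in> V"
    using E p q sgraph_in[OF graph] by blast+
  have sym: "E v u" "E u a" "E u b" "E v a" "E v b" "E p v" "E q u" "\<not> E p u" "\<not> E q v" "\<not> E b a"
    using E p q edge_sym by blast+
  have K_off: "u \<notin> K" "v \<notin> K" "p \<notin> K" "q \<notin> K" "a \<notin> K" "b \<notin> K"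
    using K(3) E p q sym by blast+
  have pq: "p \<noteq> q" "\<not> E p q"
  proof -
    show "p \<noteq> q" using p q by auto
    \<comment> \<open>An edge here would complete the square v, p, q, u.\<close>
    show "\<not> E p q" using no_square[of v p q u] p q sym E by auto
  qed
  obtain x y where xy: "x \<in> K" "E p x" "y \<in> K" "E q y" using p q by blast
  obtain r where r: "r \<noteq> []" "successively E r" "set r \<subseteq> K" "hd r = x" "last r = y"
    using connected_in_walk[OF K(2)[OF xy(1,3)]] .
  obtain f where f: "induced_path V E f" "set f \<subseteq> K" "E p (hd f)" "E q (last f)"
    "\<And>z. z \<in> set f \<Longrightarrow> E p z \<Longrightarrow> z = hd f" "\<And>z. z \<in> set f \<Longrightarrow> E q z \<Longrightarrow> z = last f"
    by (rule shortest_path[OF graph K(1) r(1-3), of "E p" "E q"]) (use r xy in auto)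
  have f_ne: "f \<noteq> []" using f(1) unfolding induced_path_def by simp
  then have f_len: "1 \<le> length f" by (simp add: Suc_le_eq)
  have f_off: "u \<notin> set f" "v \<notin> set f" "p \<notin> set f" "q \<notin> set f" "a \<notin> set f" "b \<notin> set f"
    using f(2) K_off by auto
  have uf: "\<not> E u z" "\<not> E z u" "\<not> E v z" if "z \<in> set f" for z
    using K(3)[of z] that f(2) edge_sym[of z u] by auto
  have qf: "E z q \<longleftrightarrow> z = last f" if "z \<in> set f" for z
    using that f(4,6) edge_sym[of z q] by auto
  have pf: "E p z \<longleftrightarrow> z = hd f" if "z \<in> set f" for z
    using that f(3,5) by auto
  have neq: "p \<noteq> v" "q \<noteq> u" "u \<noteq> v" "a \<noteq> u" "a \<noteq> v" "b \<noteq> u" "b \<noteq> v" "a \<noteq> p" "a \<noteq> q" "b \<noteq> p" "b \<noteq> q"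
    using E p q sym by auto
  let ?P = "p # f @ [q]"
  have P1: "induced_path V E (f @ [q])"
    by (rule path_snoc) (use V f f_off qf in auto)
  have P2: "induced_path V E ?P"
    by (rule path_Cons) (use V P1 f_off pq pf f_ne in \<open>auto simp: hd_append\<close>)
  have P3: "induced_path V E (?P @ [u])"
    by (rule path_snoc) (use V P2 f_off sym q p uf neq pq in auto)
  have H: "is_hole V E (v # ?P @ [u])"
    by (rule is_hole_Cons[OF graph P3]) (use V f_off f_ne sym p q uf neq E in \<open>auto simp: Suc_le_eq\<close>)
  define w where "w = nth (v # ?P @ [u])"
  define n where "n = length ?P"
  have w0: "w 0 = v" and wn: "w (Suc n) = u"
    unfolding w_def n_def by (simp_all only: nth_Cons_0 nth_Cons_Suc nth_append_length)
  \<comment> \<open>The offset 2 skips \<open>v\<close> and \<open>p\<close>, so indices 2 to n - 1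
    enumerate \<open>f\<close>.\<close>
  have wK: "w i \<in> K" if i: "2 \<le> i" "i < n" for i
  proof -
    obtain k where k: "i = Suc (Suc k)" using i(1) by (metis add_2_eq_Suc le_Suc_ex)
    then have "k < length f" using i(2) unfolding n_def by simp
    then have "w i = f ! k" "f ! k \<in> set f" unfolding w_def k by (auto simp: nth_append)
    then show ?thesis using f(2) by auto
  qed
  have wset: "w ` {..Suc n} = set (v # ?P @ [u])"
  proof -
    have "{..Suc n} = {0..<length (v # ?P @ [u])}" unfolding n_def by auto
    then show ?thesis
      unfolding w_def using nth_image[of "length (v # ?P @ [u])" "v # ?P @ [u]"] by simp
  qed
  interpret attached_hubs V E n w a b K
  proof
    show "cycle_map V E (Suc n) w"
      using is_hole_cycle_map[OF H] unfolding w_def n_def by simp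
    show "2 \<le> n" unfolding n_def by simp
    show "a \<notin> w ` {..Suc n}" "b \<notin> w ` {..Suc n}" unfolding wset using f_off neq by auto
  qed (use V E K wK in \<open>auto simp: w0 wn\<close>)
  show False by (rule impossible)
qed

end

subsection \<open>From separation to connected attachments\<close>

text \<open>Allows a hole to be read starting from a chosen vertex.\<close>

lemma is_hole_rotate:
  assumes h: "is_hole V E xs"
  shows "is_hole V E (rotate k xs)"
proof -
  let ?n = "length xs" and ?ys = "rotate k xs"
  have d: "distinct xs" and n: "0 < ?n" using h unfolding is_hole_def by auto
  have nth: "?ys ! i = xs ! ((k + i) mod ?n)" if "i < ?n" for i
    using that by (simp add: nth_rotate add.commute)
  have succ: "(k + j) mod ?n = Suc ((k + i) mod ?n) mod ?n \<longleftrightarrow> j = Suc i mod ?n"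
    if "i < ?n" "j < ?n" for i j
  proof -
    have "Suc ((k + i) mod ?n) mod ?n = (k + Suc i mod ?n) mod ?n"
      by (metis add_Suc_right mod_Suc_eq mod_add_right_eq)
    then have "(k + j) mod ?n = Suc ((k + i) mod ?n) mod ?n \<longleftrightarrow>
        xs ! ((k + j) mod ?n) = xs ! ((k + Suc i mod ?n) mod ?n)"
      using d n by (simp add: nth_eq_iff_index_eq)
    also have "\<dots> \<longleftrightarrow> ?ys ! j = ?ys ! (Suc i mod ?n)"
      using that n by (simp add: nth)
    also have "\<dots> \<longleftrightarrow> j = Suc i mod ?n"
      using that n d by (simp add: nth_eq_iff_index_eq)
    finally show ?thesis .
  qed
  have "E (?ys ! i) (?ys ! j) \<longleftrightarrow> j = Suc i mod ?n \<or> i = Suc j mod ?n"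
    if ij: "i < ?n" "j < ?n" for i j
  proof -
    have "E (?ys ! i) (?ys ! j) \<longleftrightarrow> (k + j) mod ?n = Suc ((k + i) mod ?n) mod ?n \<or>
        (k + i) mod ?n = Suc ((k + j) mod ?n) mod ?n"
      unfolding nth[OF ij(1)] nth[OF ij(2)] using h n unfolding is_hole_def by (meson mod_less_divisor)
    then show ?thesis using succ[OF ij] succ[OF ij(2,1)] by simp
  qed
  then show ?thesis using h unfolding is_hole_def by simp
qed

section \<open>Walks and components\<close>

lemma connected_in_refl: "x \<in> X \<Longrightarrow> connected_in E X x x"
  unfolding connected_in_def by simp

lemma connected_in_step: "connected_in E X x y \<Longrightarrow> z \<in> X \<Longrightarrow> E y z \<Longrightarrow> connected_in E X x z"
  unfolding connected_in_def
  using rtranclp.rtrancl_into_rtrancl[of "\<lambda>a b. a \<in> X \<and> b \<in> X \<and> E a b" x y z] by blast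

lemma connected_in_sym:
  assumes g: "sgraph V E" and "connected_in E X x y"
  shows "connected_in E X y x"
proof -
  have "symp (\<lambda>a b. a \<in> X \<and> b \<in> X \<and> E a b)"
    by (rule sympI) (auto simp: sgraph_sym[OF g])
  from sympD[OF symp_rtranclp[OF this], of x y] show ?thesis
    using assms(2) unfolding connected_in_def by simp
qed

lemma connected_in_trans:
  "connected_in E X x y \<Longrightarrow> connected_in E X y z \<Longrightarrow> connected_in E X x z"
  unfolding connected_in_def
  using rtranclp_trans[of "\<lambda>a b. a \<in> X \<and> b \<in> X \<and> E a b" x y z] by blast

text \<open>Every vertex on a walk in \<open>X\<close> from \<open>r\<close> is itself reachable
  from \<open>r\<close>, so the walk stays in \<open>K\<close>.\<close>

lemma component_connected:
  assumes g: "sgraph V E" and K: "K = {y. connected_in E X r y}" and "x \<in> K" "y \<in> K"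
  shows "connected_in E K x y"
proof -
  have "connected_in E K r z" if "z \<in> K" for z
  proof -
    have "(\<lambda>a b. a \<in> X \<and> b \<in> X \<and> E a b)\<^sup>*\<^sup>* r z" "r \<in> X"
      using that K unfolding connected_in_def by auto
    then show ?thesis
    proof (induction rule: rtranclp_induct)
      case base
      then show ?case using K connected_in_refl by (metis mem_Collect_eq)
    next
      case (step y z)
      then have "z \<in> K"
        using K connected_in_step[of E X r y z] unfolding connected_in_def by blast
      then show ?case using step connected_in_step by metis
    qed
  qed
  then show ?thesis using assms connected_in_sym connected_in_trans by metis
qed

text \<open>Follow the walk from \<open>v\<close> to \<open>r\<close> backwards. It stays in the
  component of \<open>r\<close> until it meets a neighbor of \<open>v\<close>, and that neighbor is
  outside N[u] because the walk avoids N[u] apart from \<open>v\<close>.\<close>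

lemma neighbor_attached_to_component:
  assumes g: "sgraph V E" and X: "X = V - cnbhd V E u - cnbhd V E v" and "r \<in> X"
    and con: "connected_in E (V - (cnbhd V E u - {v})) v r"
  shows "\<exists>p. E v p \<and> \<not> E u p \<and> p \<noteq> u \<and> (\<exists>x. connected_in E X r x \<and> E p x)"
proof -
  let ?Y = "V - (cnbhd V E u - {v})"
  have "(\<lambda>a b. a \<in> ?Y \<and> b \<in> ?Y \<and> E a b)\<^sup>*\<^sup>* v r"
    using con unfolding connected_in_def by blast
  \<comment> \<open>The backward induction shows that each vertex of the walk is in the component
    unless \<open>att\<close> holds. At \<open>v\<close> only \<open>att\<close> remains, since
    \<open>v\<close> is not in \<open>X\<close>.\<close>
  define att where "att \<longleftrightarrow> (\<exists>p. E v p \<and> \<not> E u p \<and> p \<noteq> u \<and> (\<exists>x. connected_in E X r x \<and> E p x))"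
  from \<open>(\<lambda>a b. a \<in> ?Y \<and> b \<in> ?Y \<and> E a b)\<^sup>*\<^sup>* v r\<close>
  have "connected_in E X r v \<or> att"
  proof (induction rule: converse_rtranclp_induct)
    case base
    then show ?case using connected_in_refl[OF \<open>r \<in> X\<close>] by blast
  next
    case (step y z)
    show ?case
    proof (cases "connected_in E X r z")
      case True
      then have "z \<in> X" unfolding connected_in_def by blast
      then have "y \<noteq> v" using step(1) unfolding X cnbhd_def by blast
      show ?thesis
      proof (cases "E v y")
        case True
        moreover have "\<not> E u y" "y \<noteq> u" "E y z"
          using step(1) \<open>y \<noteq> v\<close> unfolding cnbhd_def by auto
        ultimately show ?thesis using \<open>connected_in E X r z\<close> unfolding att_def by blast
      next
        case False
        then have "y \<in> X" using step(1) \<open>y \<noteq> v\<close> unfolding X cnbhd_def by auto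
        then have "connected_in E X r y"
          using True step(1) sgraph_sym[OF g, of y z] connected_in_step[of E X r z y] by blast
        then show ?thesis by blast
      qed
    next
      case False
      then show ?thesis using step by blast
    qed
  qed
  moreover have "\<not> connected_in E X r v"
    unfolding X connected_in_def cnbhd_def by blast
  ultimately show ?thesis unfolding att_def by blast
qed

text \<open>A component of G - N[u] contains neither \<open>u\<close> nor a neighbor of
  \<open>u\<close>, so its closed neighborhood misses \<open>u\<close>.\<close>

lemma breaks_self:
  assumes g: "sgraph V E" and "u \<in> Y"
  shows "breaks V E u Y"
  unfolding breaks_def
proof
  fix D assume "D \<in> components E (V - cnbhd V E u)"
  then have "D \<subseteq> V - cnbhd V E u"
    unfolding components_def connected_in_def by auto
  then have "u \<notin> D" "\<And>x. x \<in> D \<Longrightarrow> \<not> E u x" unfolding cnbhd_def by auto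
  then have "u \<notin> D" "\<not> (\<exists>x\<in>D. E x u)" using g unfolding sgraph_def by blast+
  then show "\<not> Y \<subseteq> cnbhd_set V E D"
    using assms unfolding cnbhd_set_def by blast
qed

context prism_C4_odd_hole_free
begin

text \<open>If neither set separates, both \<open>u\<close> and \<open>v\<close> reach the component
  of G - N[u] - N[v] that contains the rest of \<open>H\<close>. This supplies the attachments
  \<open>p\<close> and \<open>q\<close> excluded above.\<close>

lemma twin_separated:
  assumes h: "is_hole V E H" and v: "v \<in> V" "v \<notin> set H"
    and Nv: "{x\<in>set H. E v x} = {a, u, b}" and dist: "distinct [a, u, b]"
    and au: "E a u" and ub: "E u b"
  shows "\<exists>r\<in>set H - {a, u, b}. r \<in> V - cnbhd V E u - cnbhd V E v \<and>
    (\<not> connected_in E (V - (cnbhd V E u - {v})) v r \<or>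
     \<not> connected_in E (V - (cnbhd V E v - {u})) u r)"
proof (rule ccontr)
  assume neg: "\<not> ?thesis"
  have mem: "a \<in> set H" "u \<in> set H" "b \<in> set H" and Ev: "E v a" "E v u" "E v b"
    using Nv by blast+
  obtain k where k: "k < length H" "H ! k = u" using mem by (metis in_set_conv_nth)
  define m where "m = length H - 1"
  \<comment> \<open>Here \<open>w\<close> runs along \<open>H\<close> itself, starting at
    \<open>u\<close>.\<close>
  define w where "w = nth (rotate k H)"
  have len: "4 \<le> length H" "length H \<noteq> 4"
    using h C4_free unfolding is_hole_def C4_free_def by blast+
  then have m: "4 \<le> m" "length H = Suc m" unfolding m_def by auto
  have cm: "cycle_map V E m w"
    using is_hole_cycle_map[OF is_hole_rotate[OF h]] unfolding w_def m_def by simp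
  have w_eq: "w i = w j \<longleftrightarrow> i = j" if "i \<le> m" "j \<le> m" for i j
    using cm that unfolding cycle_map_def by (auto dest: inj_onD)
  have w_edge: "E (w i) (w j) \<longleftrightarrow> j = Suc i \<or> i = Suc j \<or> i = 0 \<and> j = m \<or> j = 0 \<and> i = m"
    if "i \<le> m" "j \<le> m" for i j
    using cm that unfolding cycle_map_def by blast
  have set_w: "x \<in> set H \<longleftrightarrow> (\<exists>i\<le>m. x = w i)" for x
  proof -
    have "x \<in> set (rotate k H) \<longleftrightarrow> (\<exists>i\<le>m. x = w i)"
      unfolding in_set_conv_nth w_def using m(2) by (auto simp: less_Suc_eq_le)
    then show ?thesis by simp
  qed
  have wV: "w i \<in> V" if "i \<le> m" for i using cm that unfolding cycle_map_def by auto
  have w0: "w 0 = u"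
    using k nth_rotate[of 0 H k] unfolding w_def by (cases "H = []") auto
  have ends: "x = w 1 \<or> x = w m" if "x \<in> set H" "E u x" for x
    using that set_w w_edge[of 0] w0 m by auto
  \<comment> \<open>The direction of the traversal stays open; \<open>a\<close> and \<open>b\<close>
    play symmetric roles.\<close>
  have ab: "a = w 1 \<and> b = w m \<or> a = w m \<and> b = w 1"
    using ends[of a] ends[of b] mem au ub dist edge_sym[of a u] by auto
  have rest: "w i \<in> set H - {a, u, b}" if "2 \<le> i" "i < m" for i
  proof -
    have "w i \<in> set H" unfolding set_w using that by (intro exI[of _ i]) auto
    then show ?thesis
      using that ab w0 w_eq[of i 0] w_eq[of i 1] w_eq[of i m] by auto
  qed
  let ?X = "V - cnbhd V E u - cnbhd V E v"
  have inX: "w i \<in> ?X" if "2 \<le> i" "i < m" for i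
  proof -
    have "\<not> E v (w i)" "w i \<noteq> v" using rest[OF that] Nv v by auto
    moreover have "\<not> E u (w i)" using w_edge[of 0 i] w0 that by auto
    ultimately show ?thesis using wV[of i] rest[OF that] that unfolding cnbhd_def by auto
  qed
  \<comment> \<open>The subpath from \<open>w 2\<close> to \<open>w (m - 1)\<close> lies in
    \<open>?X\<close>, so this one component contains all of it.\<close>
  define K where "K = {y. connected_in E ?X (w 2) y}"
  have K_X: "K \<subseteq> ?X" unfolding K_def connected_in_def by blast
  have wK: "w i \<in> K" if "2 \<le> i" "i < m" for i
    using that
  proof (induction i rule: dec_induct)
    case base
    then show ?case unfolding K_def using inX[of 2] by (simp add: connected_in_refl)
  next
    case (step i)
    then have "connected_in E ?X (w 2) (w i)" "E (w i) (w (Suc i))"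
      using w_edge[of i "Suc i"] unfolding K_def by auto
    then show ?case
      unfolding K_def using inX[of "Suc i"] step by (simp add: connected_in_step)
  qed
  have r: "w 2 \<in> set H - {a, u, b}" "w 2 \<in> ?X" using rest[of 2] inX[of 2] m by auto
  then have con: "connected_in E (V - (cnbhd V E u - {v})) v (w 2)"
    "connected_in E (V - (cnbhd V E v - {u})) u (w 2)"
    using neg by blast+
  have X': "?X = V - cnbhd V E v - cnbhd V E u" by blast
  obtain p where p: "E v p" "\<not> E u p" "p \<noteq> u" "\<exists>x\<in>K. E p x"
    using neighbor_attached_to_component[OF graph refl r(2) con(1)] unfolding K_def by blast
  obtain q where q: "E u q" "\<not> E v q" "q \<noteq> v" "\<exists>x\<in>K. E q x"
    using neighbor_attached_to_component[OF graph X' r(2) con(2)] unfolding K_def by blast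
  have nbr: "\<exists>x\<in>K. E (w 1) x" "\<exists>x\<in>K. E (w m) x"
  proof -
    have "E (w 1) (w 2)" "E (w m) (w (m - 1))" using w_edge m by auto
    then show "\<exists>x\<in>K. E (w 1) x" "\<exists>x\<in>K. E (w m) x"
      using wK[of 2] wK[of "m - 1"] m by auto
  qed
  show False
  proof (rule no_twin_attachments[of u v a b K p q])
    show "E u v" "E a u" "E a v" "E b u" "E b v"
      using Ev au ub edge_sym by blast+
    show "\<not> E a b" using ab w_edge[of 1 m] w_edge[of m 1] m by auto
    show "a \<noteq> b" using dist by simp
    show "K \<subseteq> V" using K_X by blast
    show "connected_in E K x y" if "x \<in> K" "y \<in> K" for x y
      using component_connected[OF graph K_def that] .
    show "\<not> E u x \<and> \<not> E v x" if "x \<in> K" for x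
      using that K_X unfolding cnbhd_def by auto
    show "\<exists>x\<in>K. E a x" "\<exists>x\<in>K. E b x" using ab nbr by auto
  qed (use p q in auto)
qed

end

theorem theorem5p5:
  fixes V :: "'a set" and E :: "'a \<Rightarrow> 'a \<Rightarrow> bool"
    and H :: "'a list" and v a u b :: 'a
  assumes "sgraph V E" and "C4_free V E" and "prism_free V E" and "perfect V E"
    and "twin_wheel V E H v"
    and "{x\<in>set H. E v x} = {a, u, b}" and "distinct [a, u, b]"
    and "E a u" and "E u b"
  shows "((is_cutset V E (cnbhd V E u - {v}) \<and>
          (\<exists>w\<in>set H - {a, u, b}. w \<notin> cnbhd V E u - {v} \<and>
             \<not> connected_in E (V - (cnbhd V E u - {v})) v w))
       \<or> (is_cutset V E (cnbhd V E v - {u}) \<and>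
          (\<exists>w\<in>set H - {a, u, b}. w \<notin> cnbhd V E v - {u} \<and>
             \<not> connected_in E (V - (cnbhd V E v - {u})) u w)))
       \<and> (breaks V E v (set H - {a, b}) \<or> breaks V E u (set H - {a, b}))"
proof -
  interpret prism_C4_odd_hole_free V E
    by unfold_locales (fact assms(1) | fact assms(2) | fact assms(3) | erule perfect_hole_even[OF assms(1,4)])+
  have h: "is_hole V E H" and v: "v \<in> V" "v \<notin> set H"
    using assms(5) unfolding twin_wheel_def is_wheel_def by auto
  have u: "u \<in> set H" "u \<in> V" using assms(6) h unfolding is_hole_def by auto
  obtain r where r: "r \<in> set H - {a, u, b}" "r \<in> V - cnbhd V E u - cnbhd V E v"
    and sep: "\<not> connected_in E (V - (cnbhd V E u - {v})) v r \<or>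
      \<not> connected_in E (V - (cnbhd V E v - {u})) u r"
    using twin_separated[OF h v assms(6-9)] by blast
  \<comment> \<open>The vertices \<open>y\<close> and \<open>r\<close> themselves witness the
    disconnection.\<close>
  have cutset: "is_cutset V E (cnbhd V E x - {y})"
    if "x \<in> V" "y \<in> V" "r \<notin> cnbhd V E x" "\<not> connected_in E (V - (cnbhd V E x - {y})) y r" for x y
  proof -
    have "cnbhd V E x - {y} \<subseteq> V" using that unfolding cnbhd_def by auto
    moreover have "y \<in> V - (cnbhd V E x - {y})" "r \<in> V - (cnbhd V E x - {y})"
      using that r by blast+
    ultimately show ?thesis using that(4) unfolding is_cutset_def by blast
  qed
  \<comment> \<open>\<open>u\<close> belongs to the set to be broken, so \<open>breaks_self\<close>
    settles the final claim.\<close>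
  have "breaks V E u (set H - {a, b})"
    using u assms(7) by (intro breaks_self[OF graph]) auto
  then show ?thesis
    using sep cutset[OF u(2) v(1)] cutset[OF v(1) u(2)] r by blast
qed

end
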